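(* Fix $k\ge1$ and assume hypothesis $(\mathrm{H}_k)$: for every $n\ge k$, every $\rho\in[-1,0]$ and every measurable $f:\mathbb{R}^n\to B^k$, $\mathrm{Stab}_\rho[f]\ge\mathrm{Stab}_\rho[f^{(k)}_{\mathrm{opt}}]$ where $f^{(k)}_{\mathrm{opt}}(x)=x_{\le k}/\|x_{\le k}\|$. Let $-1<\rho\le0$. Then for every $\varepsilon>0$ there exist $\delta=\delta(\varepsilon,\rho)>0$ and $m=m(\varepsilon,\rho)\ge0$ such that for every $n$ and every $f=(f_1,\dots,f_k):\{-1,1\}^n\to B^k$ satisfying $\sum_{j=1}^k\mathrm{Inf}^{\le m}_i[f_j]\le\delta$ for all $i\in[n]$, \[\mathbf{Stab}_\rho[f]\ge F^*(k,\rho)-\varepsilon.\]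
   Context: For $f:\{-1,1\}^n\to\mathbb{R}$ with Fourier expansion $f=\sum_{S\subseteq[n]}\hat f(S)\chi_S$, $\chi_S(x)=\prod_{i\in S}x_i$, define $\mathrm{Inf}^{\le m}_i[f]=\sum_{|S|\le m,\,S\ni i}\hat f(S)^2$. For $f=(f_1,\dots,f_k)$, $\mathbf{Stab}_\rho[f]=\mathbb{E}\langle f(\mathbf{x}),f(\mathbf{y})\rangle=\sum_S\rho^{|S|}\sum_j\hat f_j(S)^2$, where $\mathbf{x}$ is uniform on $\{-1,1\}^n$ and each $\mathbf{y}_i$ independently equals $\mathbf{x}_i$ with probability $\tfrac12+\tfrac12\rho$ and $-\mathbf{x}_i$ otherwise. For $g:\mathbb{R}^n\to\mathbb{R}^k$, $\mathrm{Stab}_\rho[g]=\mathbb{E}_{\mathbf{x}\sim_\rho\mathbf{y}}\langle g(\mathbf{x}),g(\mathbf{y})\rangle$ with $\rho$-correlated standard Gaussians. $x_{\le k}=(x_1,\dots,x_k)$. $F^*(k,\rho)=\mathbb{E}\langle\mathbf{Z}u/\|\mathbf{Z}u\|,\mathbf{Z}v/\|\mathbf{Z}v\|\rangle$ for unit vectors $u,v$ with $\langle u,v\rangle=\rho$ and $\mathbf{Z}$ a $k\times m'$ matrix of i.i.d. standard Gaussians (equal to $\mathrm{Stab}_\rho[f^{(k)}_{\mathrm{opt}}]$). *)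

theory Defs
  imports "HOL-Probability.Probability"
begin

text \<open>Standard Gaussian measure on R^n, points represented as extensional
  functions on the index set {..<n} (coordinates 0..n-1).\<close>
definition gauss_space :: "nat \<Rightarrow> (nat \<Rightarrow> real) measure" where
  "gauss_space n = PiM {..<n} (\<lambda>_. density lborel std_normal_density)"

definition inner_k :: "nat \<Rightarrow> (nat \<Rightarrow> real) \<Rightarrow> (nat \<Rightarrow> real) \<Rightarrow> real" where
  "inner_k k u v = (\<Sum>j<k. u j * v j)"

definition in_ball_k :: "nat \<Rightarrow> (nat \<Rightarrow> real) \<Rightarrow> bool" where
  "in_ball_k k u \<longleftrightarrow> (\<Sum>j<k. (u j)^2) \<le> 1"

text \<open>rho-correlated partner: y = rho x + sqrt(1-rho^2) z with x, z independent standard Gaussians.\<close>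
definition corr :: "nat \<Rightarrow> real \<Rightarrow> (nat \<Rightarrow> real) \<Rightarrow> (nat \<Rightarrow> real) \<Rightarrow> (nat \<Rightarrow> real)" where
  "corr n \<rho> x z = (\<lambda>i\<in>{..<n}. \<rho> * x i + sqrt (1 - \<rho>^2) * z i)"

definition gauss_stab :: "nat \<Rightarrow> nat \<Rightarrow> real \<Rightarrow> ((nat \<Rightarrow> real) \<Rightarrow> nat \<Rightarrow> real) \<Rightarrow> real" where
  "gauss_stab n k \<rho> g =
     (\<integral>x. (\<integral>z. inner_k k (g x) (g (corr n \<rho> x z)) \<partial>gauss_space n) \<partial>gauss_space n)"

definition gauss_ball_fun :: "nat \<Rightarrow> nat \<Rightarrow> ((nat \<Rightarrow> real) \<Rightarrow> nat \<Rightarrow> real) \<Rightarrow> bool" where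
  "gauss_ball_fun n k g \<longleftrightarrow>
     (\<forall>j<k. (\<lambda>x. g x j) \<in> borel_measurable (gauss_space n)) \<and>
     (\<forall>x\<in>space (gauss_space n). in_ball_k k (g x))"

text \<open>f_opt^(k)(x) = x_{<=k} / |x_{<=k}| (value 0 at the null set x_{<=k} = 0).\<close>
definition f_opt :: "nat \<Rightarrow> (nat \<Rightarrow> real) \<Rightarrow> nat \<Rightarrow> real" where
  "f_opt k x = (\<lambda>j. if j < k then x j / sqrt (\<Sum>i<k. (x i)^2) else 0)"

definition Fstar :: "nat \<Rightarrow> real \<Rightarrow> real" where
  "Fstar k \<rho> = gauss_stab k k \<rho> (f_opt k)"

definition cube :: "nat \<Rightarrow> (nat \<Rightarrow> real) set" where
  "cube n = PiE {..<n} (\<lambda>_. {-1, 1})"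

definition chi :: "nat set \<Rightarrow> (nat \<Rightarrow> real) \<Rightarrow> real" where
  "chi S x = (\<Prod>i\<in>S. x i)"

definition fourier :: "nat \<Rightarrow> ((nat \<Rightarrow> real) \<Rightarrow> real) \<Rightarrow> nat set \<Rightarrow> real" where
  "fourier n f S = (\<Sum>x\<in>cube n. f x * chi S x) / 2^n"

definition low_inf :: "nat \<Rightarrow> nat \<Rightarrow> nat \<Rightarrow> ((nat \<Rightarrow> real) \<Rightarrow> real) \<Rightarrow> real" where
  "low_inf n m i f = (\<Sum>S\<in>{S. S \<subseteq> {..<n} \<and> card S \<le> m \<and> i \<in> S}. (fourier n f S)^2)"

text \<open>Boolean noise stability E <f(x), f(y)>, x uniform, y_i = x_i with prob (1+rho)/2.\<close>
definition bool_stab :: "nat \<Rightarrow> nat \<Rightarrow> real \<Rightarrow> ((nat \<Rightarrow> real) \<Rightarrow> nat \<Rightarrow> real) \<Rightarrow> real" where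
  "bool_stab n k \<rho> f =
     (\<Sum>x\<in>cube n. \<Sum>y\<in>cube n.
        (\<Prod>i<n. if y i = x i then (1 + \<rho>) / 2 else (1 - \<rho>) / 2) / 2^n
        * inner_k k (f x) (f y))"

end

theory Submission
  imports Defs
begin

text \<open>
  Replace \<open>f\<close> by the multilinear polynomial \<open>p\<close> obtained from it by applying the noise operator \<open>T\<^sub>r\<close>,
  with \<open>r\<close> close to \<open>1\<close>, and discarding the Fourier coefficients of degree above \<open>m\<close>. Since
  \<open>\<bar>\<rho>\<bar> < 1\<close> this changes the stability little, and on the cube \<open>p\<close> is within \<open>r\<^sup>m\<close> in \<open>L\<^sup>2\<close> of
  the ball-valued function \<open>T\<^sub>r f\<close>. Replacing the signs by Gaussians one coordinate at a time, with
  hypercontractivity controlling the Taylor remainders through the influences, shows that \<open>p\<close> is also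
  close in \<open>L\<^sup>2\<close> to the ball on Gaussian space. The Gaussian stability of \<open>p\<close> has the same Fourier formula
  as the Boolean one, so the hypothesis on Gaussian space, applied to the radial projection of \<open>p\<close>
  onto the ball, gives the bound.
\<close>

section \<open>A smooth penalty for leaving the unit ball\<close>

text \<open>The squared distance to the ball is only once continuously differentiable across the
  sphere, too little for a Taylor comparison with cubic remainder. In \<open>excess_loss\<close> the
  fourth power gives three derivatives and the cubed denominator restores quadratic growth in the
  norm, which also keeps third derivatives bounded. The price is fourth-order vanishing at the
  sphere, so the squared distance is recovered only up to an additive \<open>\<eta>\<^sup>2\<close>.
  The cubic remainder is split into second and fourth moments, so that an L^4 hypercontractive
  estimate controls it. The replacement error is then the square root of the largest influence times
  the sum of all influences; the latter is at most \<open>m\<close>, which removes the dependence on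
  \<open>n\<close>. For negative \<open>\<rho>\<close> the multipliers
  \<open>\<rho> ^ card S\<close> alternate in sign, so dropping coefficients may move the stability
  either way and is bounded in absolute value. The parameters are chosen in a forced order:
  \<open>r\<close> before \<open>m\<close>, which must make \<open>r ^ m\<close> small, and the
  influence threshold last, since it has to beat \<open>9 ^ m\<close>.\<close>

text \<open>The exponent starts at two because a derivative is needed at the kink as well: there the
  difference quotient is bounded by \<open>\<bar>h\<bar> ^ Suc n\<close>, which tends to 0.\<close>

lemma has_real_derivative_max0_power:
  fixes x :: real
  shows "((\<lambda>x. (max 0 x) ^ Suc (Suc n)) has_real_derivative real (Suc (Suc n)) * (max 0 x) ^ Suc n) (at x)"
proof -
  consider "x < 0" | "x > 0" | "x = 0" by linarith
  then show ?thesis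
  proof cases
    case 1
    have "((\<lambda>x::real. 0::real) has_real_derivative 0) (at x)" by simp
    then have "((\<lambda>x::real. (max 0 x) ^ Suc (Suc n)) has_real_derivative 0) (at x)"
      by (rule has_field_derivative_transform_within_open[where S="{..<0}"]) (use 1 in auto)
    then show ?thesis using 1 by simp
  next
    case 2
    have "((\<lambda>x::real. x ^ Suc (Suc n)) has_real_derivative real (Suc (Suc n)) * x ^ Suc n) (at x)"
      using DERIV_pow[of "Suc (Suc n)" x] by simp
    then have "((\<lambda>x::real. (max 0 x) ^ Suc (Suc n)) has_real_derivative real (Suc (Suc n)) * x ^ Suc n) (at x)"
      by (rule has_field_derivative_transform_within_open[where S="{0<..}"]) (use 2 in auto)
    then show ?thesis using 2 by simp
  next
    case 3
    have "((\<lambda>h::real. (max 0 h) ^ Suc (Suc n) / h) \<longlongrightarrow> 0) (at 0)"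
    proof (rule Lim_null_comparison)
      show "\<forall>\<^sub>F h in at 0. norm ((max 0 h) ^ Suc (Suc n) / h) \<le> \<bar>h\<bar> ^ Suc n"
      proof (rule always_eventually, rule allI)
        fix h :: real
        show "norm ((max 0 h) ^ Suc (Suc n) / h) \<le> \<bar>h\<bar> ^ Suc n"
          by (cases "h > 0") (auto simp: max_def mult_nonpos_nonneg)
      qed
      show "((\<lambda>h::real. \<bar>h\<bar> ^ Suc n) \<longlongrightarrow> 0) (at 0)"
        by (intro tendsto_null_power tendsto_rabs_zero tendsto_ident_at) auto
    qed
    then show ?thesis using 3 by (simp add: DERIV_def)
  qed
qed

text \<open>A \<open>C\<^sup>3\<close> surrogate, as a function of the squared norm, for the squared distance to the unit ball:
  it is at most a multiple of that distance, controls it up to any small additive error, and its third derivative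
  along a line in direction \<open>b\<close> is \<open>O(\<bar>b\<bar>\<^sup>3)\<close> uniformly in the base point.\<close>

definition excess_loss :: "real \<Rightarrow> real" where
  "excess_loss s = (max 0 (s - 1)) ^ 4 / (1 + s) ^ 3"

text \<open>Here \<open>q\<close> plays the squared norm along a line, and \<open>h1\<close>,
  \<open>h2\<close>, \<open>h3\<close> are the first three derivatives of \<open>excess_loss\<close>
  taken at \<open>q t\<close>. Since \<open>q\<close> is quadratic, the third-order chain rule has
  only two terms. Nonnegativity of \<open>q t\<close> keeps the denominator \<open>w t\<close> away
  from 0.\<close>

lemma excess_loss_deriv_along_quadratic:
  fixes \<alpha> \<beta> \<gamma> :: real
  defines "q \<equiv> \<lambda>t. \<alpha> + 2 * \<beta> * t + \<gamma> * t\<^sup>2"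
  defines "m \<equiv> \<lambda>t. max 0 (q t - 1)" and "q' \<equiv> \<lambda>t. 2 * \<beta> + 2 * \<gamma> * t"
    and "w \<equiv> \<lambda>t. 1 + q t"
  defines "h1 \<equiv> \<lambda>t. 4 * m t ^ 3 / w t ^ 3 - 3 * m t ^ 4 / w t ^ 4"
    and "h2 \<equiv> \<lambda>t. 12 * m t ^ 2 / w t ^ 3 - 24 * m t ^ 3 / w t ^ 4 + 12 * m t ^ 4 / w t ^ 5"
    and "h3 \<equiv> \<lambda>t. 24 * m t / w t ^ 3 - 108 * m t ^ 2 / w t ^ 4 + 144 * m t ^ 3 / w t ^ 5 - 60 * m t ^ 4 / w t ^ 6"
  assumes pos: "q t \<ge> 0"
  shows "((\<lambda>t. excess_loss (q t)) has_real_derivative h1 t * q' t) (at t)"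
    and "((\<lambda>t. h1 t * q' t) has_real_derivative h2 t * (q' t)\<^sup>2 + 2 * \<gamma> * h1 t) (at t)"
    and "((\<lambda>t. h2 t * (q' t)\<^sup>2 + 2 * \<gamma> * h1 t) has_real_derivative
            h3 t * (q' t) ^ 3 + 6 * \<gamma> * h2 t * q' t) (at t)"
proof -
  have w: "w t \<noteq> 0" using pos by (simp add: w_def)
  have dq: "(q has_real_derivative q' t) (at t)"
    unfolding q_def q'_def by (auto intro!: derivative_eq_intros)
  have dq': "(q' has_real_derivative 2 * \<gamma>) (at t)"
    unfolding q'_def by (auto intro!: derivative_eq_intros)
  have dw: "(w has_real_derivative q' t) (at t)"
    unfolding w_def by (auto intro!: derivative_eq_intros dq)
  have dm: "((\<lambda>t. m t ^ Suc (Suc n)) has_real_derivative real (Suc (Suc n)) * m t ^ Suc n * q' t) (at t)" for n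
  proof -
    have "((\<lambda>t. q t - 1) has_real_derivative q' t) (at t)"
      by (auto intro!: derivative_eq_intros dq)
    from DERIV_chain2[OF has_real_derivative_max0_power this] show ?thesis
      unfolding m_def by simp
  qed
  have dm2: "((\<lambda>t. m t ^ 2) has_real_derivative 2 * m t * q' t) (at t)"
    using dm[of 0] by (simp add: eval_nat_numeral)
  have dm3: "((\<lambda>t. m t ^ 3) has_real_derivative 3 * m t ^ 2 * q' t) (at t)"
    using dm[of 1] by (simp add: eval_nat_numeral)
  have dm4: "((\<lambda>t. m t ^ 4) has_real_derivative 4 * m t ^ 3 * q' t) (at t)"
    using dm[of 2] by (simp add: eval_nat_numeral)
  \<comment> \<open>One quotient rule serves every summand: the derivatives of \<open>w\<close> and
    of the powers of \<open>m\<close> all carry the factor \<open>q' t\<close>, which is pulled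
    out.\<close>
  have dquot: "((\<lambda>t. c * F t / w t ^ Suc n) has_real_derivative
      (c * F' / w t ^ Suc n - real (Suc n) * c * F t / w t ^ Suc (Suc n)) * q' t) (at t)"
    if "(F has_real_derivative F' * q' t) (at t)" for F F' n c
    by (rule derivative_eq_intros that dw refl | simp add: w)+ (use w in \<open>simp add: field_simps\<close>)
  have dh: "((\<lambda>t. m t ^ 4 / w t ^ 3) has_real_derivative h1 t * q' t) (at t)"
    using dquot[OF dm4, of 1 2] by (simp add: h1_def eval_nat_numeral)
  then show "((\<lambda>t. excess_loss (q t)) has_real_derivative h1 t * q' t) (at t)"
    unfolding excess_loss_def m_def w_def .
  have dh1: "(h1 has_real_derivative h2 t * q' t) (at t)"
    using DERIV_diff[OF dquot[OF dm3, of 4 2] dquot[OF dm4, of 3 3]]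
    unfolding h1_def h2_def by (simp add: eval_nat_numeral algebra_simps add_divide_distrib diff_divide_distrib)
  have dh2: "(h2 has_real_derivative h3 t * q' t) (at t)"
    using DERIV_add[OF DERIV_diff[OF dquot[OF dm2, of 12 2] dquot[OF dm3, of 24 3]] dquot[OF dm4, of 12 4]]
    unfolding h2_def h3_def by (simp add: eval_nat_numeral algebra_simps add_divide_distrib diff_divide_distrib)
  show "((\<lambda>t. h1 t * q' t) has_real_derivative h2 t * (q' t)\<^sup>2 + 2 * \<gamma> * h1 t) (at t)"
    by (rule derivative_eq_intros dh1 dq' | simp)+ (simp add: power2_eq_square)
  show "((\<lambda>t. h2 t * (q' t)\<^sup>2 + 2 * \<gamma> * h1 t) has_real_derivative
            h3 t * (q' t) ^ 3 + 6 * \<gamma> * h2 t * q' t) (at t)"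
    by (rule derivative_eq_intros dh1 dh2 dq' | simp)+ (simp add: eval_nat_numeral algebra_simps)
qed


text \<open>With \<open>v = m / w\<close> in [0, 1], the two brackets are polynomials in
  \<open>v\<close> divided by \<open>w\<^sup>2\<close> and by \<open>w\<close>. Since
  \<open>sqrt s \<le> w\<close> and \<open>sqrt s ^ 3 \<le> w\<^sup>2\<close>, these denominators
  absorb the growth of \<open>q'\<close>, and the bound is uniform in \<open>s\<close>. The constant
  is \<open>8 * (24 + 108 + 144 + 60) + 6 * 2 * (12 + 24 + 12)\<close>.\<close>

lemma excess_loss_third_deriv_bound:
  fixes m w B s q' :: real
  assumes "0 \<le> m" "m \<le> w" "w = 1 + s" "0 \<le> s" "0 \<le> B" "\<bar>q'\<bar> \<le> 2 * B * sqrt s"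
  shows "\<bar>(24 * m / w ^ 3 - 108 * m ^ 2 / w ^ 4 + 144 * m ^ 3 / w ^ 5 - 60 * m ^ 4 / w ^ 6) * q' ^ 3
           + 6 * B\<^sup>2 * (12 * m ^ 2 / w ^ 3 - 24 * m ^ 3 / w ^ 4 + 12 * m ^ 4 / w ^ 5) * q'\<bar> \<le> 3264 * B ^ 3"
proof -
  define v where "v = m / w"
  define R where "R = sqrt s"
  have w: "w \<ge> 1" "w > 0" using assms by auto
  have R: "0 \<le> R" "R\<^sup>2 = s" using assms by (auto simp: R_def)
  have "0 \<le> (R - 1)\<^sup>2" by simp
  then have Rw: "R \<le> w" using R assms by (simp add: power2_eq_square algebra_simps)
  have R3: "R ^ 3 \<le> w\<^sup>2"
  proof -
    have "R ^ 3 = R * R\<^sup>2" by (simp add: eval_nat_numeral)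
    also have "\<dots> \<le> w * w" using R Rw assms w by (intro mult_mono) auto
    finally show ?thesis by (simp add: power2_eq_square)
  qed
  have v: "0 \<le> v" "v \<le> 1" using assms w by (auto simp: v_def)
  have vp: "0 \<le> v ^ n \<and> v ^ n \<le> 1" for n using v by (simp add: power_le_one)
  have q1: "\<bar>q'\<bar> \<le> 2 * B * R" using assms by (simp add: R_def)
  have q3: "\<bar>q'\<bar> ^ 3 \<le> 8 * B ^ 3 * R ^ 3"
    using power_mono[OF q1, of 3] by (simp add: power_mult_distrib)
  have e3: "24 * m / w ^ 3 - 108 * m ^ 2 / w ^ 4 + 144 * m ^ 3 / w ^ 5 - 60 * m ^ 4 / w ^ 6
      = (24 * v - 108 * v^2 + 144 * v^3 - 60 * v^4) / w\<^sup>2"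
    using w by (simp add: v_def field_simps eval_nat_numeral)
  have e2: "12 * m ^ 2 / w ^ 3 - 24 * m ^ 3 / w ^ 4 + 12 * m ^ 4 / w ^ 5
      = (12 * v^2 - 24 * v^3 + 12 * v^4) / w"
    using w by (simp add: v_def field_simps eval_nat_numeral)
  have b3: "\<bar>24 * v - 108 * v^2 + 144 * v^3 - 60 * v^4\<bar> \<le> 336"
    using v vp[of 2] vp[of 3] vp[of 4] by linarith
  have b2: "\<bar>12 * v^2 - 24 * v^3 + 12 * v^4\<bar> \<le> 48"
    using vp[of 2] vp[of 3] vp[of 4] by linarith
  have "\<bar>(24 * v - 108 * v^2 + 144 * v^3 - 60 * v^4) / w\<^sup>2 * q' ^ 3\<bar>
      = \<bar>24 * v - 108 * v^2 + 144 * v^3 - 60 * v^4\<bar> * \<bar>q'\<bar> ^ 3 / w\<^sup>2"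
    by (simp add: abs_mult power_abs)
  also have "\<dots> \<le> 336 * (8 * B ^ 3 * R ^ 3) / w\<^sup>2"
    by (intro divide_right_mono mult_mono b3 q3) auto
  also have "\<dots> \<le> 336 * (8 * B ^ 3 * w\<^sup>2) / w\<^sup>2"
    using assms by (intro divide_right_mono mult_left_mono R3) auto
  also have "\<dots> = 2688 * B ^ 3" using w by simp
  finally have t1: "\<bar>(24 * v - 108 * v^2 + 144 * v^3 - 60 * v^4) / w\<^sup>2 * q' ^ 3\<bar> \<le> 2688 * B ^ 3" .
  have "\<bar>6 * B\<^sup>2 * ((12 * v^2 - 24 * v^3 + 12 * v^4) / w) * q'\<bar>
      = 6 * B\<^sup>2 * (\<bar>12 * v^2 - 24 * v^3 + 12 * v^4\<bar> * \<bar>q'\<bar>) / w"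
    using w by (simp add: abs_mult)
  also have "\<dots> \<le> 6 * B\<^sup>2 * (48 * (2 * B * w)) / w"
  proof (intro divide_right_mono mult_left_mono mult_mono b2)
    show "\<bar>q'\<bar> \<le> 2 * B * w" using q1 mult_left_mono[OF Rw, of "2 * B"] assms by simp
  qed (use w in auto)
  also have "\<dots> = 576 * B ^ 3" using w by (simp add: eval_nat_numeral)
  finally have t2: "\<bar>6 * B\<^sup>2 * ((12 * v^2 - 24 * v^3 + 12 * v^4) / w) * q'\<bar> \<le> 576 * B ^ 3" .
  show ?thesis unfolding e3 e2 by (rule order_trans[OF abs_triangle_ineq]) (use t1 t2 in linarith)
qed

text \<open>The coefficients \<open>c1\<close> and \<open>c2\<close> stay anonymous: two laws with
  equal mean and variance give the Taylor polynomial the same integral, so only the remainder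
  matters. The constant is 3264 / 3!.\<close>

lemma excess_loss_taylor:
  fixes a b :: "nat \<Rightarrow> real"
  obtains c1 c2 where "\<And>t. \<bar>excess_loss (\<Sum>j<k. (a j + t * b j)\<^sup>2)
      - (excess_loss (\<Sum>j<k. (a j)\<^sup>2) + c1 * t + c2 * t\<^sup>2)\<bar> \<le> 544 * sqrt (\<Sum>j<k. (b j)\<^sup>2) ^ 3 * \<bar>t\<bar> ^ 3"
proof -
  define \<alpha> \<beta> \<gamma> where "\<alpha> = (\<Sum>j<k. (a j)\<^sup>2)" and "\<beta> = (\<Sum>j<k. a j * b j)" and "\<gamma> = (\<Sum>j<k. (b j)\<^sup>2)"
  define q where "q = (\<lambda>t. \<alpha> + 2 * \<beta> * t + \<gamma> * t\<^sup>2)"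
  define m where "m = (\<lambda>t. max 0 (q t - 1))"
  define q' where "q' = (\<lambda>t. 2 * \<beta> + 2 * \<gamma> * t)"
  define w where "w = (\<lambda>t. 1 + q t)"
  define h1 where "h1 = (\<lambda>t. 4 * m t ^ 3 / w t ^ 3 - 3 * m t ^ 4 / w t ^ 4)"
  define h2 where "h2 = (\<lambda>t. 12 * m t ^ 2 / w t ^ 3 - 24 * m t ^ 3 / w t ^ 4 + 12 * m t ^ 4 / w t ^ 5)"
  define h3 where "h3 = (\<lambda>t. 24 * m t / w t ^ 3 - 108 * m t ^ 2 / w t ^ 4 + 144 * m t ^ 3 / w t ^ 5 - 60 * m t ^ 4 / w t ^ 6)"
  note defs = q_def m_def q'_def w_def h1_def h2_def h3_def
  have q: "q t = (\<Sum>j<k. (a j + t * b j)\<^sup>2)" for t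
    by (simp add: q_def \<alpha>_def \<beta>_def \<gamma>_def power2_sum sum.distrib sum_distrib_left sum_distrib_right
        power_mult_distrib ac_simps)
  have q0: "q t \<ge> 0" for t unfolding q by (intro sum_nonneg) auto
  have g0: "\<gamma> \<ge> 0" unfolding \<gamma>_def by (intro sum_nonneg) auto
  \<comment> \<open>Cauchy-Schwarz between \<open>b\<close> and the point \<open>a + t * b\<close>;
    this is the hypothesis on \<open>q'\<close> in the third-derivative bound, with
    \<open>B = sqrt \<gamma>\<close>.\<close>
  have q'2: "\<bar>q' t\<bar> \<le> 2 * sqrt \<gamma> * sqrt (q t)" for t
  proof -
    have e: "q' t = 2 * (\<Sum>j<k. b j * (a j + t * b j))"
      by (simp add: q'_def \<beta>_def \<gamma>_def algebra_simps sum.distrib sum_distrib_left power2_eq_square)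
    have "(\<Sum>j<k. b j * (a j + t * b j))\<^sup>2 \<le> \<gamma> * q t"
      unfolding \<gamma>_def q by (rule Cauchy_Schwarz_ineq_sum)
    then have "\<bar>\<Sum>j<k. b j * (a j + t * b j)\<bar> \<le> sqrt (\<gamma> * q t)"
      by (metis real_sqrt_abs real_sqrt_le_iff)
    then show ?thesis unfolding e by (simp add: real_sqrt_mult)
  qed
  define diff where "diff = (\<lambda>(n::nat) t. if n = 0 then excess_loss (q t) else if n = 1 then h1 t * q' t
     else if n = 2 then h2 t * (q' t)\<^sup>2 + 2 * \<gamma> * h1 t else h3 t * (q' t) ^ 3 + 6 * \<gamma> * h2 t * q' t)"
  have D: "DERIV (diff n) t :> diff (Suc n) t" if "n < 3" for n t
  proof -
    note E = excess_loss_deriv_along_quadratic[of \<alpha> \<beta> t \<gamma>, OF q0[of t, unfolded q_def]]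
    have "((\<lambda>t. excess_loss (q t)) has_real_derivative h1 t * q' t) (at t)"
      "((\<lambda>t. h1 t * q' t) has_real_derivative h2 t * (q' t)\<^sup>2 + 2 * \<gamma> * h1 t) (at t)"
      "((\<lambda>t. h2 t * (q' t)\<^sup>2 + 2 * \<gamma> * h1 t) has_real_derivative
            h3 t * (q' t) ^ 3 + 6 * \<gamma> * h2 t * q' t) (at t)"
      unfolding defs by (fact E)+
    moreover have "n = 0 \<or> n = 1 \<or> n = 2" using that by auto
    ultimately show ?thesis by (auto simp: diff_def)
  qed
  have B: "\<bar>diff 3 t\<bar> \<le> 3264 * sqrt \<gamma> ^ 3" for t
  proof -
    have "\<bar>h3 t * (q' t) ^ 3 + 6 * (sqrt \<gamma>)\<^sup>2 * h2 t * q' t\<bar> \<le> 3264 * sqrt \<gamma> ^ 3"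
      unfolding h3_def h2_def
      by (rule excess_loss_third_deriv_bound[where s="q t"]) (use q0[of t] g0 q'2 in \<open>auto simp: m_def w_def\<close>)
    then show ?thesis using g0 by (simp add: diff_def)
  qed
  show thesis
  proof (rule that[of "diff 1 0" "diff 2 0 / 2"])
    fix t
    obtain x where x: "diff 0 t = (\<Sum>n<3. diff n 0 / fact n * t ^ n) + diff 3 x / fact 3 * t ^ 3"
      using Maclaurin_bi_le[of diff "diff 0" 3 t] D by blast
    have "diff 0 t - (diff 0 0 + diff 1 0 * t + diff 2 0 / 2 * t\<^sup>2) = diff 3 x / 6 * t ^ 3"
      unfolding x by (simp add: eval_nat_numeral)
    then have "\<bar>diff 0 t - (diff 0 0 + diff 1 0 * t + diff 2 0 / 2 * t\<^sup>2)\<bar> = \<bar>diff 3 x / 6 * t ^ 3\<bar>"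
      by (rule arg_cong)
    also have "\<dots> = \<bar>diff 3 x\<bar> / 6 * \<bar>t\<bar> ^ 3"
      by (simp add: abs_mult power_abs)
    also have "\<dots> \<le> 3264 * sqrt \<gamma> ^ 3 / 6 * \<bar>t\<bar> ^ 3"
      by (intro mult_right_mono divide_right_mono B) auto
    finally have "\<bar>diff 0 t - (diff 0 0 + diff 1 0 * t + diff 2 0 / 2 * t\<^sup>2)\<bar> \<le> 544 * sqrt \<gamma> ^ 3 * \<bar>t\<bar> ^ 3"
      by simp
    moreover have "diff 0 t = excess_loss (\<Sum>j<k. (a j + t * b j)\<^sup>2)" "diff 0 0 = excess_loss (\<Sum>j<k. (a j)\<^sup>2)"
      using q[of 0] by (simp_all add: diff_def q)
    ultimately show "\<bar>excess_loss (\<Sum>j<k. (a j + t * b j)\<^sup>2)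
      - (excess_loss (\<Sum>j<k. (a j)\<^sup>2) + diff 1 0 * t + diff 2 0 / 2 * t\<^sup>2)\<bar>
      \<le> 544 * sqrt (\<Sum>j<k. (b j)\<^sup>2) ^ 3 * \<bar>t\<bar> ^ 3"
      by (simp add: \<gamma>_def)
  qed
qed

lemma excess_loss_nonneg: "0 \<le> s \<Longrightarrow> 0 \<le> excess_loss s"
  by (simp add: excess_loss_def)

lemma excess_loss_le_self:
  assumes "0 \<le> s" shows "excess_loss s \<le> s"
proof -
  define m where "m = max 0 (s - 1)"
  have m: "0 \<le> m" "m \<le> 1 + s" "m \<le> s" using assms by (auto simp: m_def)
  have "m ^ 4 / (1 + s) ^ 3 = m * (m / (1 + s)) ^ 3"
    by (simp add: power_divide eval_nat_numeral)
  also have "\<dots> \<le> m * 1" using m assms by (intro mult_left_mono power_le_one) auto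
  finally show ?thesis using m by (simp add: excess_loss_def m_def)
qed

lemma excess_loss_measurable [measurable]: "excess_loss \<in> borel_measurable borel"
  unfolding excess_loss_def[abs_def] by measurable

text \<open>Used on the cube, where the distance to the ball is controlled directly. The factor 16
  comes from \<open>r + 1 \<le> 2 * r\<close> outside the ball.\<close>

lemma excess_loss_upper:
  assumes "0 \<le> r"
  shows "excess_loss (r\<^sup>2) \<le> 16 * (max 0 (r - 1))\<^sup>2"
proof (cases "r \<le> 1")
  case True
  then have "r\<^sup>2 \<le> 1" using assms by (simp add: power_le_one)
  then show ?thesis using True by (simp add: excess_loss_def max_def)
next
  case False
  then have r: "r > 1" by simp
  then have r2: "r\<^sup>2 > 1" by simp
  have "excess_loss (r\<^sup>2) = (r - 1) ^ 4 * (r + 1) ^ 4 / (1 + r\<^sup>2) ^ 3"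
  proof -
    have "r\<^sup>2 - 1 = (r - 1) * (r + 1)" by (simp add: power2_eq_square algebra_simps)
    then show ?thesis using r2 by (simp add: excess_loss_def power_mult_distrib)
  qed
  also have "\<dots> \<le> (r - 1) ^ 4 * (2 * r) ^ 4 / (r\<^sup>2) ^ 3"
    using r by (intro frac_le mult_left_mono power_mono) auto
  also have "\<dots> = 16 * (r - 1)\<^sup>2 * ((r - 1) / r)\<^sup>2" using r by (simp add: field_simps eval_nat_numeral)
  also have "\<dots> \<le> 16 * (r - 1)\<^sup>2 * 1"
    using r by (intro mult_left_mono power_le_one) auto
  finally show ?thesis using r by simp
qed

text \<open>Used on Gaussian space, to return from the penalty to the distance. Near the sphere
  \<open>excess_loss\<close> is of fourth order in \<open>r - 1\<close>, so no purely multiplicative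
  bound can hold; \<open>\<eta>\<^sup>2\<close> absorbs the shell \<open>r - 1 \<le> \<eta>\<close>,
  and beyond it \<open>d / (d + 2)\<close> with \<open>d = r - 1\<close> is at least
  \<open>\<eta> / (\<eta> + 2)\<close>.\<close>

lemma excess_loss_lower:
  assumes "0 \<le> r" "0 < \<eta>"
  shows "(max 0 (r - 1))\<^sup>2 \<le> \<eta>\<^sup>2 + ((\<eta> + 2) / \<eta>)\<^sup>2 * excess_loss (r\<^sup>2)"
proof (cases "r - 1 \<le> \<eta>")
  case True
  then have "(max 0 (r - 1))\<^sup>2 \<le> \<eta>\<^sup>2" using assms by (intro power_mono) auto
  then show ?thesis using excess_loss_nonneg[of "r\<^sup>2"] by (simp add: add_increasing2)
next
  case False
  define d where "d = r - 1"
  have d: "d > \<eta>" "d > 0" "r = d + 1" using False assms by (auto simp: d_def)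
  then have "r\<^sup>2 > 1" by simp
  moreover have "r\<^sup>2 - 1 = d * (d + 2)" using d by (simp add: power2_eq_square algebra_simps)
  ultimately have "excess_loss (r\<^sup>2) = d ^ 4 * (d + 2) ^ 4 / (1 + r\<^sup>2) ^ 3"
    by (simp add: excess_loss_def power_mult_distrib)
  also have "\<dots> \<ge> d ^ 4 * (d + 2) ^ 4 / ((d + 2)\<^sup>2) ^ 3"
  proof -
    have "1 + r\<^sup>2 \<le> (d + 2)\<^sup>2" using d by (simp add: power2_eq_square algebra_simps)
    then show ?thesis using d by (intro divide_left_mono power_mono mult_pos_pos) (auto simp: add_pos_nonneg)
  qed
  also have "d ^ 4 * (d + 2) ^ 4 / ((d + 2)\<^sup>2) ^ 3 = d\<^sup>2 * (d / (d + 2))\<^sup>2"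
  proof -
    have "d ^ 4 * e ^ 4 / (e\<^sup>2) ^ 3 = d\<^sup>2 * (d / e)\<^sup>2" if "e > 0" for e
      using that by (simp add: field_simps eval_nat_numeral)
    from this[of "d + 2"] show ?thesis using d by simp
  qed
  finally have L: "d\<^sup>2 * (d / (d + 2))\<^sup>2 \<le> excess_loss (r\<^sup>2)" .
  have "\<eta> / (\<eta> + 2) \<le> d / (d + 2)" using d assms by (simp add: field_simps)
  then have "(\<eta> / (\<eta> + 2))\<^sup>2 \<le> (d / (d + 2))\<^sup>2" using assms by (intro power_mono) auto
  then have "d\<^sup>2 * (\<eta> / (\<eta> + 2))\<^sup>2 \<le> excess_loss (r\<^sup>2)"
    using L mult_left_mono[of "(\<eta> / (\<eta> + 2))\<^sup>2" "(d / (d + 2))\<^sup>2" "d\<^sup>2"] by simp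
  then have "((\<eta> + 2) / \<eta>)\<^sup>2 * (d\<^sup>2 * (\<eta> / (\<eta> + 2))\<^sup>2) \<le> ((\<eta> + 2) / \<eta>)\<^sup>2 * excess_loss (r\<^sup>2)"
    by (intro mult_left_mono) auto
  moreover have "((\<eta> + 2) / \<eta>)\<^sup>2 * (d\<^sup>2 * (\<eta> / (\<eta> + 2))\<^sup>2) = d\<^sup>2"
    using assms by (simp add: power_divide)
  ultimately have "d\<^sup>2 \<le> ((\<eta> + 2) / \<eta>)\<^sup>2 * excess_loss (r\<^sup>2)" by simp
  moreover have "max 0 (r - 1) = d" using d by simp
  ultimately show ?thesis by (simp add: add_increasing)
qed

section \<open>Multilinear polynomials of independent standardised variables\<close>

text \<open>The same coefficients are evaluated at signs, where this is a Fourier expansion, and at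
  Gaussian points.\<close>

definition mlpoly :: "nat set \<Rightarrow> (nat set \<Rightarrow> real) \<Rightarrow> (nat \<Rightarrow> real) \<Rightarrow> real" where
  "mlpoly I c x = (\<Sum>S\<in>Pow I. c S * chi S x)"

lemma sum_Pow_insert:
  fixes g :: "'a set \<Rightarrow> 'b::comm_monoid_add"
  assumes "finite I" "i \<notin> I"
  shows "sum g (Pow (insert i I)) = sum g (Pow I) + (\<Sum>S\<in>Pow I. g (insert i S))"
proof -
  have "sum g (Pow (insert i I)) = sum g (Pow I) + sum g (insert i ` Pow I)"
    unfolding Pow_insert using assms by (intro sum.union_disjoint) auto
  also have "sum g (insert i ` Pow I) = (\<Sum>S\<in>Pow I. g (insert i S))"
    using assms by (intro sum.reindex_cong[of "insert i"]) (auto simp: inj_on_def insert_eq_iff)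
  finally show ?thesis .
qed

text \<open>The form \<open>a + x i * b\<close>, with \<open>a\<close> and \<open>b\<close> free of
  \<open>x i\<close>, carries the moment inductions and the replacement of a single
  coordinate.\<close>

lemma mlpoly_insert:
  assumes "finite I" "i \<notin> I"
  shows "mlpoly (insert i I) c x = mlpoly I c x + x i * mlpoly I (\<lambda>S. c (insert i S)) x"
proof -
  have "c (insert i S) * chi (insert i S) x = x i * (c (insert i S) * chi S x)" if "S \<in> Pow I" for S
  proof -
    have "finite S" "i \<notin> S" using that assms finite_subset by auto
    then show ?thesis by (simp add: chi_def)
  qed
  then have "(\<Sum>S\<in>Pow I. c (insert i S) * chi (insert i S) x) = x i * mlpoly I (\<lambda>S. c (insert i S)) x"
    unfolding mlpoly_def sum_distrib_left by (rule sum.cong[OF refl])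
  then show ?thesis
    using assms by (simp add: mlpoly_def sum_Pow_insert)
qed

lemma mlpoly_fun_upd:
  assumes "i \<notin> I"
  shows "mlpoly I c (x(i := t)) = mlpoly I c x"
  unfolding mlpoly_def chi_def using assms by (intro sum.cong arg_cong2[of _ _ _ _ "(*)"] prod.cong) auto

lemma mlpoly_insert_fun_upd:
  assumes "finite I" "i \<notin> I"
  shows "mlpoly (insert i I) c (x(i := t)) = mlpoly I c x + t * mlpoly I (\<lambda>S. c (insert i S)) x"
  using assms by (simp add: mlpoly_insert mlpoly_fun_upd)

text \<open>What random signs and Gaussians share: mean 0 and variance 1 make quadratic Taylor
  polynomials indistinguishable, while a vanishing third moment and a fourth moment of at most 3
  (the Gaussian value) make the hypercontractive recursion close.\<close>

definition standardised :: "real measure \<Rightarrow> bool" where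
  "standardised \<mu> \<longleftrightarrow> prob_space \<mu> \<and> sets \<mu> = sets borel \<and> integrable \<mu> (\<lambda>t. t ^ 4) \<and>
     (\<integral>t. t \<partial>\<mu>) = 0 \<and> (\<integral>t. t\<^sup>2 \<partial>\<mu>) = 1 \<and> (\<integral>t. t ^ 3 \<partial>\<mu>) = 0 \<and> (\<integral>t. t ^ 4 \<partial>\<mu>) \<le> 3"

lemma standardised_integrable_power:
  assumes "standardised \<mu>" "n \<le> 4"
  shows "integrable \<mu> (\<lambda>t. t ^ n)"
proof -
  interpret prob_space \<mu> using assms by (simp add: standardised_def)
  have s[measurable_cong]: "sets \<mu> = sets borel" using assms by (simp add: standardised_def)
  have "integrable \<mu> (\<lambda>t. 1 + t ^ 4)" using assms by (simp add: standardised_def)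
  then show ?thesis
  proof (rule Bochner_Integration.integrable_bound)
    show "(\<lambda>t. t ^ n) \<in> borel_measurable \<mu>" by measurable
    have "\<bar>t\<bar> ^ n \<le> 1 + t ^ 4" for t :: real
    proof (cases "\<bar>t\<bar> \<le> 1")
      case True
      then have "\<bar>t\<bar> ^ n \<le> 1" by (simp add: power_le_one)
      then show ?thesis by (simp add: add_increasing2)
    next
      case False
      then have "\<bar>t\<bar> ^ n \<le> \<bar>t\<bar> ^ 4" using assms by (intro power_increasing) auto
      then show ?thesis by (simp add: power_even_abs_numeral)
    qed
    then show "AE t in \<mu>. norm (t ^ n) \<le> norm (1 + t ^ 4)"
      by (auto simp: power_abs abs_of_nonneg add_nonneg_nonneg)
  qed
qed

lemma standardised_integral_quartic:
  assumes "standardised \<mu>"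
  shows "integrable \<mu> (\<lambda>t. c0 + c1 * t + c2 * t\<^sup>2 + c3 * t ^ 3 + c4 * t ^ 4)"
    and "(\<integral>t. c0 + c1 * t + c2 * t\<^sup>2 + c3 * t ^ 3 + c4 * t ^ 4 \<partial>\<mu>) = c0 + c2 + c4 * (\<integral>t. t ^ 4 \<partial>\<mu>)"
proof -
  interpret prob_space \<mu> using assms by (simp add: standardised_def)
  have i: "integrable \<mu> (\<lambda>t. t)" "integrable \<mu> (\<lambda>t. t\<^sup>2)" "integrable \<mu> (\<lambda>t. t ^ 3)" "integrable \<mu> (\<lambda>t. t ^ 4)"
    using standardised_integrable_power[OF assms, of 1] standardised_integrable_power[OF assms, of 2]
      standardised_integrable_power[OF assms, of 3] standardised_integrable_power[OF assms, of 4] by simp_all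
  show "integrable \<mu> (\<lambda>t. c0 + c1 * t + c2 * t\<^sup>2 + c3 * t ^ 3 + c4 * t ^ 4)" using i by simp
  show "(\<integral>t. c0 + c1 * t + c2 * t\<^sup>2 + c3 * t ^ 3 + c4 * t ^ 4 \<partial>\<mu>) = c0 + c2 + c4 * (\<integral>t. t ^ 4 \<partial>\<mu>)"
    using i assms by (simp add: standardised_def prob_space)
qed

text \<open>Cauchy-Schwarz applied to the squares. The fourth-moment bounds are given as squares,
  the form of the hypercontractive estimate, so that the mixed term comes out as
  \<open>A * B\<close>.\<close>

lemma integral_product_squares_le:
  fixes f g :: "'a \<Rightarrow> real"
  assumes [measurable]: "f \<in> borel_measurable M" "g \<in> borel_measurable M"
    and f: "integrable M (\<lambda>x. f x ^ 4)" "(\<integral>x. f x ^ 4 \<partial>M) \<le> A\<^sup>2" "0 \<le> A"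
    and g: "integrable M (\<lambda>x. g x ^ 4)" "(\<integral>x. g x ^ 4 \<partial>M) \<le> B\<^sup>2" "0 \<le> B"
  shows "integrable M (\<lambda>x. (f x)\<^sup>2 * (g x)\<^sup>2)" "(\<integral>x. (f x)\<^sup>2 * (g x)\<^sup>2 \<partial>M) \<le> A * B"
proof -
  have "integrable M (\<lambda>x. f x ^ 4 + g x ^ 4)" using f g by simp
  then show i: "integrable M (\<lambda>x. (f x)\<^sup>2 * (g x)\<^sup>2)"
  proof (rule Bochner_Integration.integrable_bound)
    have "(u::real)\<^sup>2 * v\<^sup>2 \<le> u ^ 4 + v ^ 4" for u v
    proof -
      have "0 \<le> (u\<^sup>2 - v\<^sup>2)\<^sup>2" "0 \<le> u ^ 4" "0 \<le> v ^ 4" by auto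
      moreover have "(u\<^sup>2 - v\<^sup>2)\<^sup>2 = u ^ 4 + v ^ 4 - 2 * (u\<^sup>2 * v\<^sup>2)"
        by (simp add: power2_eq_square eval_nat_numeral algebra_simps)
      ultimately show ?thesis by linarith
    qed
    then show "AE x in M. norm ((f x)\<^sup>2 * (g x)\<^sup>2) \<le> norm (f x ^ 4 + g x ^ 4)"
      by (auto simp: abs_of_nonneg add_nonneg_nonneg)
  qed measurable
  define X where "X = (\<integral>x. (f x)\<^sup>2 * (g x)\<^sup>2 \<partial>M)"
  have X0: "0 \<le> X" unfolding X_def by (intro integral_nonneg_AE) auto
  have e: "(\<integral>\<^sup>+x. ennreal ((f x)\<^sup>2) * ennreal ((g x)\<^sup>2) \<partial>M) = ennreal X"
    unfolding X_def using i by (subst nn_integral_eq_integral[symmetric]) (auto simp: ennreal_mult)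
  have e1: "(\<integral>\<^sup>+x. ennreal ((f x)\<^sup>2) ^ 2 \<partial>M) = ennreal (\<integral>x. f x ^ 4 \<partial>M)"
    using f by (subst nn_integral_eq_integral[symmetric]) (auto simp: ennreal_power simp flip: power_mult)
  have e2: "(\<integral>\<^sup>+x. ennreal ((g x)\<^sup>2) ^ 2 \<partial>M) = ennreal (\<integral>x. g x ^ 4 \<partial>M)"
    using g by (subst nn_integral_eq_integral[symmetric]) (auto simp: ennreal_power simp flip: power_mult)
  have "ennreal (X\<^sup>2) \<le> ennreal (\<integral>x. f x ^ 4 \<partial>M) * ennreal (\<integral>x. g x ^ 4 \<partial>M)"
    using Cauchy_Schwarz_nn_integral[of "\<lambda>x. ennreal ((f x)\<^sup>2)" M "\<lambda>x. ennreal ((g x)\<^sup>2)"] X0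
    unfolding e e1 e2 by (simp add: ennreal_power)
  also have "\<dots> = ennreal ((\<integral>x. f x ^ 4 \<partial>M) * (\<integral>x. g x ^ 4 \<partial>M))"
    by (rule ennreal_mult[symmetric]) (auto intro!: integral_nonneg_AE)
  finally have "X\<^sup>2 \<le> (\<integral>x. f x ^ 4 \<partial>M) * (\<integral>x. g x ^ 4 \<partial>M)"
    by (subst (asm) ennreal_le_iff) (auto intro!: integral_nonneg_AE mult_nonneg_nonneg)
  also have "\<dots> \<le> A\<^sup>2 * B\<^sup>2" using f g by (intro mult_mono) (auto intro!: integral_nonneg_AE)
  finally have "X\<^sup>2 \<le> (A * B)\<^sup>2" by (simp add: power_mult_distrib)
  then have "X \<le> A * B" by (rule power2_le_imp_le) (use f g in auto)
  then show "(\<integral>x. (f x)\<^sup>2 * (g x)\<^sup>2 \<partial>M) \<le> A * B" by (simp add: X_def)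
qed

text \<open>Nonnegativity lets Tonelli run through \<open>nn_integral\<close>, so integrability of
  \<open>f\<close> is a conclusion, deduced from that of the inner integral \<open>g\<close>. The
  inductions over coordinates need this form, since there only \<open>g\<close> is already known to
  be integrable.\<close>

lemma (in product_sigma_finite) nonneg_product_integral_insert:
  fixes f :: "('i \<Rightarrow> 'a) \<Rightarrow> real"
  assumes fin: "finite I" "i \<notin> I"
    and f: "f \<in> borel_measurable (PiM (insert i I) M)" "\<And>x. 0 \<le> f x"
    and inner: "\<And>y. y \<in> space (PiM I M) \<Longrightarrow> integrable (M i) (\<lambda>t. f (y(i := t)))"
      "\<And>y. y \<in> space (PiM I M) \<Longrightarrow> (\<integral>t. f (y(i := t)) \<partial>M i) = g y"
    and g: "integrable (PiM I M) g"
  shows "integrable (PiM (insert i I) M) f" "integral\<^sup>L (PiM (insert i I) M) f = integral\<^sup>L (PiM I M) g"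
proof -
  have g0: "0 \<le> g y" if "y \<in> space (PiM I M)" for y
    unfolding inner(2)[OF that, symmetric] by (rule integral_nonneg_AE) (simp add: f(2))
  have "(\<integral>\<^sup>+x. ennreal (f x) \<partial>PiM (insert i I) M) = (\<integral>\<^sup>+y. (\<integral>\<^sup>+t. ennreal (f (y(i := t))) \<partial>M i) \<partial>PiM I M)"
    using f fin by (intro product_nn_integral_insert) auto
  also have "\<dots> = (\<integral>\<^sup>+y. ennreal (g y) \<partial>PiM I M)"
  proof (rule nn_integral_cong)
    fix y assume y: "y \<in> space (PiM I M)"
    show "(\<integral>\<^sup>+t. ennreal (f (y(i := t))) \<partial>M i) = ennreal (g y)"
      using nn_integral_eq_integral[OF inner(1)[OF y]] f(2) inner(2)[OF y] by simp
  qed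
  also have "\<dots> = ennreal (integral\<^sup>L (PiM I M) g)"
    using g g0 by (intro nn_integral_eq_integral) auto
  finally have e: "(\<integral>\<^sup>+x. ennreal (f x) \<partial>PiM (insert i I) M) = ennreal (integral\<^sup>L (PiM I M) g)" .
  have g0': "0 \<le> integral\<^sup>L (PiM I M) g" using g0 by (intro integral_nonneg_AE) auto
  show "integrable (PiM (insert i I) M) f"
    by (rule integrableI_nn_integral_finite[OF f(1) _ e]) (use f(2) in auto)
  show "integral\<^sup>L (PiM (insert i I) M) f = integral\<^sup>L (PiM I M) g"
    using f e g0' by (intro integral_eq_nn_integral[THEN trans]) auto
qed

locale standardised_family =
  fixes M :: "nat \<Rightarrow> real measure"
  assumes std: "standardised (M i)"
begin

lemma prob_M: "prob_space (M i)" and sets_M [measurable_cong]: "sets (M i) = sets borel"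
  using std[of i] by (auto simp: standardised_def)

sublocale product_sigma_finite M
  by unfold_locales (use prob_M prob_space_imp_sigma_finite in \<open>auto simp: sigma_finite_measure_def\<close>)

lemma prob_PiM: "prob_space (PiM I M)"
  by (intro prob_space_PiM prob_M)

lemma measurable_mlpoly [measurable]: "mlpoly I c \<in> borel_measurable (PiM I M)"
proof -
  have "(\<lambda>x. x i) \<in> borel_measurable (PiM I M)" if "i \<in> I" for i
    using measurable_component_singleton[OF that, of M] by (simp add: measurable_cong_sets[OF refl sets_M])
  then show ?thesis
    unfolding mlpoly_def[abs_def] chi_def by (intro borel_measurable_sum borel_measurable_times borel_measurable_prod) auto
qed

text \<open>Parseval: integrating out \<open>x i\<close> from \<open>(a + x i * b)\<^sup>2\<close>
  removes the cross term and leaves \<open>a\<^sup>2 + b\<^sup>2\<close>.\<close>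

lemma mlpoly_second_moment:
  assumes "finite I"
  shows "integrable (PiM I M) (\<lambda>x. (mlpoly I c x)\<^sup>2)"
    and "(\<integral>x. (mlpoly I c x)\<^sup>2 \<partial>PiM I M) = (\<Sum>S\<in>Pow I. (c S)\<^sup>2)"
proof -
  have "integrable (PiM I M) (\<lambda>x. (mlpoly I c x)\<^sup>2) \<and> (\<integral>x. (mlpoly I c x)\<^sup>2 \<partial>PiM I M) = (\<Sum>S\<in>Pow I. (c S)\<^sup>2)"
    using assms
  proof (induction I arbitrary: c rule: finite_induct)
    case empty
    interpret prob_space "PiM {} M" by (rule prob_PiM)
    show ?case by (simp add: mlpoly_def chi_def prob_space)
  next
    case (insert i I)
    define a where "a = mlpoly I c"
    define b where "b = mlpoly I (\<lambda>S. c (insert i S))"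
    have i: "integrable (PiM I M) (\<lambda>x. (a x)\<^sup>2 + (b x)\<^sup>2)"
      using insert.IH unfolding a_def b_def by simp
    \<comment> \<open>Padded with zero cubic and quartic terms to match
      \<open>standardised_integral_quartic\<close>.\<close>
    have e: "(mlpoly (insert i I) c (y(i := t)))\<^sup>2 = (a y)\<^sup>2 + (2 * a y * b y) * t + (b y)\<^sup>2 * t\<^sup>2 + 0 * t ^ 3 + 0 * t ^ 4" for y t
      using insert.hyps by (simp add: mlpoly_insert_fun_upd a_def b_def power2_eq_square algebra_simps)
    note R = nonneg_product_integral_insert[OF insert.hyps, of "\<lambda>x. (mlpoly (insert i I) c x)\<^sup>2", OF _ _ _ _ i]
    have I1: "integrable (M i) (\<lambda>t. (mlpoly (insert i I) c (y(i := t)))\<^sup>2)"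
      and I2: "(\<integral>t. (mlpoly (insert i I) c (y(i := t)))\<^sup>2 \<partial>M i) = (a y)\<^sup>2 + (b y)\<^sup>2" for y
      unfolding e using standardised_integral_quartic[OF std] by (blast, simp only:)
    have "integrable (PiM (insert i I) M) (\<lambda>x. (mlpoly (insert i I) c x)\<^sup>2)"
      by (rule R) (auto intro: I1 simp: I2)
    moreover have "(\<integral>x. (mlpoly (insert i I) c x)\<^sup>2 \<partial>PiM (insert i I) M) = (\<integral>x. (a x)\<^sup>2 + (b x)\<^sup>2 \<partial>PiM I M)"
      by (rule R) (auto intro: I1 simp: I2)
    moreover have "\<dots> = (\<Sum>S\<in>Pow I. (c S)\<^sup>2) + (\<Sum>S\<in>Pow I. (c (insert i S))\<^sup>2)"
      using insert.IH unfolding a_def b_def by simp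
    ultimately show ?case using insert.hyps by (simp add: sum_Pow_insert)
  qed
  then show "integrable (PiM I M) (\<lambda>x. (mlpoly I c x)\<^sup>2)"
    and "(\<integral>x. (mlpoly I c x)\<^sup>2 \<partial>PiM I M) = (\<Sum>S\<in>Pow I. (c S)\<^sup>2)" by auto
qed

text \<open>Hypercontractivity. The weights \<open>3 ^ card S\<close>, in place of a bound on the degree, make the
  induction over the variables close.\<close>

lemma mlpoly_fourth_moment:
  assumes "finite I"
  shows "integrable (PiM I M) (\<lambda>x. mlpoly I c x ^ 4)"
    and "(\<integral>x. mlpoly I c x ^ 4 \<partial>PiM I M) \<le> (\<Sum>S\<in>Pow I. 3 ^ card S * (c S)\<^sup>2)\<^sup>2"
proof -
  have "integrable (PiM I M) (\<lambda>x. mlpoly I c x ^ 4) \<and>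
      (\<integral>x. mlpoly I c x ^ 4 \<partial>PiM I M) \<le> (\<Sum>S\<in>Pow I. 3 ^ card S * (c S)\<^sup>2)\<^sup>2"
    using assms
  proof (induction I arbitrary: c rule: finite_induct)
    case empty
    interpret prob_space "PiM {} M" by (rule prob_PiM)
    show ?case by (simp add: mlpoly_def chi_def prob_space flip: power_mult)
  next
    case (insert i I)
    define a where "a = mlpoly I c"
    define b where "b = mlpoly I (\<lambda>S. c (insert i S))"
    define A where "A = (\<Sum>S\<in>Pow I. 3 ^ card S * (c S)\<^sup>2)"
    define B where "B = (\<Sum>S\<in>Pow I. 3 ^ card S * (c (insert i S))\<^sup>2)"
    define \<kappa> where "\<kappa> = (\<integral>t. t ^ 4 \<partial>M i)"
    have k: "\<kappa> \<le> 3" using std[of i] by (simp add: \<kappa>_def standardised_def)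
    have AB: "0 \<le> A" "0 \<le> B" by (auto simp: A_def B_def intro!: sum_nonneg)
    have a: "integrable (PiM I M) (\<lambda>x. a x ^ 4)" "(\<integral>x. a x ^ 4 \<partial>PiM I M) \<le> A\<^sup>2"
      and b: "integrable (PiM I M) (\<lambda>x. b x ^ 4)" "(\<integral>x. b x ^ 4 \<partial>PiM I M) \<le> B\<^sup>2"
      using insert.IH unfolding a_def b_def A_def B_def by auto
    have m: "a \<in> borel_measurable (PiM I M)" "b \<in> borel_measurable (PiM I M)" by (simp_all add: a_def b_def)
    note ab = integral_product_squares_le[OF m a AB(1) b AB(2)]
    have i: "integrable (PiM I M) (\<lambda>x. a x ^ 4 + 6 * ((a x)\<^sup>2 * (b x)\<^sup>2) + b x ^ 4 * \<kappa>)"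
      using a b ab by simp
    have e: "mlpoly (insert i I) c (y(i := t)) ^ 4
        = a y ^ 4 + (4 * a y ^ 3 * b y) * t + (6 * ((a y)\<^sup>2 * (b y)\<^sup>2)) * t\<^sup>2 + (4 * a y * b y ^ 3) * t ^ 3 + b y ^ 4 * t ^ 4" for y t
      using insert.hyps by (simp add: mlpoly_insert_fun_upd a_def b_def eval_nat_numeral algebra_simps)
    note R = nonneg_product_integral_insert[OF insert.hyps, of "\<lambda>x. mlpoly (insert i I) c x ^ 4", OF _ _ _ _ i]
    have I1: "integrable (M i) (\<lambda>t. mlpoly (insert i I) c (y(i := t)) ^ 4)"
      and I2: "(\<integral>t. mlpoly (insert i I) c (y(i := t)) ^ 4 \<partial>M i) = a y ^ 4 + 6 * ((a y)\<^sup>2 * (b y)\<^sup>2) + b y ^ 4 * \<kappa>" for y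
      unfolding e \<kappa>_def using standardised_integral_quartic[OF std] by (blast, simp only:)
    have "integrable (PiM (insert i I) M) (\<lambda>x. mlpoly (insert i I) c x ^ 4)"
      by (rule R) (auto intro: I1 simp: I2)
    moreover have "(\<integral>x. mlpoly (insert i I) c x ^ 4 \<partial>PiM (insert i I) M) \<le> (A + 3 * B)\<^sup>2"
    proof -
      have "(\<integral>x. mlpoly (insert i I) c x ^ 4 \<partial>PiM (insert i I) M)
          = (\<integral>x. a x ^ 4 + 6 * ((a x)\<^sup>2 * (b x)\<^sup>2) + b x ^ 4 * \<kappa> \<partial>PiM I M)"
        by (rule R) (auto intro: I1 simp: I2)
      also have "\<dots> = (\<integral>x. a x ^ 4 \<partial>PiM I M) + 6 * (\<integral>x. (a x)\<^sup>2 * (b x)\<^sup>2 \<partial>PiM I M) + \<kappa> * (\<integral>x. b x ^ 4 \<partial>PiM I M)"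
        using a b ab by simp
      also have "\<kappa> * (\<integral>x. b x ^ 4 \<partial>PiM I M) \<le> 3 * B\<^sup>2"
        using b k by (intro mult_mono) (auto intro!: integral_nonneg_AE)
      also have "(\<integral>x. a x ^ 4 \<partial>PiM I M) + 6 * (\<integral>x. (a x)\<^sup>2 * (b x)\<^sup>2 \<partial>PiM I M) + 3 * B\<^sup>2 \<le> A\<^sup>2 + 6 * (A * B) + 3 * B\<^sup>2"
        using a ab by simp
      \<comment> \<open>This fixes the weight 3: the binomial coefficient 6 is exactly the cross
        term \<open>2 * A * (3 * B)\<close>, and \<open>9 * B\<^sup>2\<close> leaves room for the
        fourth moment.\<close>
      also have "\<dots> \<le> (A + 3 * B)\<^sup>2" by (simp add: power2_eq_square algebra_simps)
      finally show ?thesis by simp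
    qed
    moreover have "(\<Sum>S\<in>Pow (insert i I). 3 ^ card S * (c S)\<^sup>2) = A + 3 * B"
    proof -
      have "3 ^ card (insert i S) * (c (insert i S))\<^sup>2 = 3 * (3 ^ card S * (c (insert i S))\<^sup>2)" if "S \<in> Pow I" for S
      proof -
        have "finite S" "i \<notin> S" using that insert.hyps finite_subset by auto
        then show ?thesis by simp
      qed
      then have "(\<Sum>S\<in>Pow I. 3 ^ card (insert i S) * (c (insert i S))\<^sup>2) = 3 * B"
        unfolding B_def sum_distrib_left by (rule sum.cong[OF refl])
      then show ?thesis using insert.hyps by (simp add: sum_Pow_insert A_def)
    qed
    ultimately show ?case by simp
  qed
  then show "integrable (PiM I M) (\<lambda>x. mlpoly I c x ^ 4)"
    and "(\<integral>x. mlpoly I c x ^ 4 \<partial>PiM I M) \<le> (\<Sum>S\<in>Pow I. 3 ^ card S * (c S)\<^sup>2)\<^sup>2" by auto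
qed

end

section \<open>The Lindeberg replacement argument\<close>

text \<open>The second bound gives an integrable majorant once this integral becomes the inner one
  over the remaining coordinates.\<close>

lemma standardised_excess_loss_integrable:
  assumes "standardised \<mu>"
  shows "integrable \<mu> (\<lambda>t. excess_loss (\<Sum>j<k. (a j + t * b j)\<^sup>2))"
    and "(\<integral>t. excess_loss (\<Sum>j<k. (a j + t * b j)\<^sup>2) \<partial>\<mu>) \<le> (\<Sum>j<k. (a j)\<^sup>2 + (b j)\<^sup>2)"
proof -
  have s[measurable_cong]: "sets \<mu> = sets borel" using assms by (simp add: standardised_def)
  define \<alpha> \<beta> \<gamma> where "\<alpha> = (\<Sum>j<k. (a j)\<^sup>2)" and "\<beta> = (\<Sum>j<k. a j * b j)" and "\<gamma> = (\<Sum>j<k. (b j)\<^sup>2)"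
  have q: "(\<Sum>j<k. (a j + t * b j)\<^sup>2) = \<alpha> + 2 * \<beta> * t + \<gamma> * t\<^sup>2 + 0 * t ^ 3 + 0 * t ^ 4" for t
    by (simp add: \<alpha>_def \<beta>_def \<gamma>_def power2_sum sum.distrib sum_distrib_left sum_distrib_right
        power_mult_distrib ac_simps)
  have i: "integrable \<mu> (\<lambda>t. \<Sum>j<k. (a j + t * b j)\<^sup>2)"
    and v: "(\<integral>t. (\<Sum>j<k. (a j + t * b j)\<^sup>2) \<partial>\<mu>) = \<alpha> + \<gamma>"
    unfolding q using standardised_integral_quartic[OF assms] by (blast, simp only:)
  have nn: "0 \<le> (\<Sum>j<k. (a j + t * b j)\<^sup>2)" for t by (intro sum_nonneg) auto
  have le: "excess_loss (\<Sum>j<k. (a j + t * b j)\<^sup>2) \<le> (\<Sum>j<k. (a j + t * b j)\<^sup>2)" for t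
    by (intro excess_loss_le_self nn)
  show i2: "integrable \<mu> (\<lambda>t. excess_loss (\<Sum>j<k. (a j + t * b j)\<^sup>2))"
    by (rule Bochner_Integration.integrable_bound[OF i]) (use le nn excess_loss_nonneg in auto)
  have "(\<integral>t. excess_loss (\<Sum>j<k. (a j + t * b j)\<^sup>2) \<partial>\<mu>) \<le> \<alpha> + \<gamma>"
    unfolding v[symmetric] by (intro integral_mono i i2 le)
  then show "(\<integral>t. excess_loss (\<Sum>j<k. (a j + t * b j)\<^sup>2) \<partial>\<mu>) \<le> (\<Sum>j<k. (a j)\<^sup>2 + (b j)\<^sup>2)"
    by (simp add: \<alpha>_def \<gamma>_def sum.distrib)
qed

text \<open>Under both laws the quadratic Taylor polynomial integrates to \<open>F 0 + c2\<close>,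
  so only the two cubic remainders are left. The free \<open>l\<close> balances variance against
  fourth moment and is later tied to the largest influence; the factor 3 bounds the fourth
  moment.\<close>

lemma standardised_excess_loss_diff:
  fixes a b :: "nat \<Rightarrow> real" and k :: nat
  assumes "standardised \<mu>" "standardised \<nu>" "0 < l"
  defines "\<beta> \<equiv> (\<Sum>j<k. (b j)\<^sup>2)"
  shows "\<bar>(\<integral>t. excess_loss (\<Sum>j<k. (a j + t * b j)\<^sup>2) \<partial>\<mu>) - (\<integral>t. excess_loss (\<Sum>j<k. (a j + t * b j)\<^sup>2) \<partial>\<nu>)\<bar>
     \<le> 544 * (l * \<beta> + 3 * \<beta>\<^sup>2 / l)"
proof -
  define F where "F = (\<lambda>t. excess_loss (\<Sum>j<k. (a j + t * b j)\<^sup>2))"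
  have b0: "0 \<le> \<beta>" unfolding \<beta>_def by (intro sum_nonneg) auto
  obtain c1 c2 where T: "\<And>t. \<bar>F t - (F 0 + c1 * t + c2 * t\<^sup>2)\<bar> \<le> 544 * sqrt \<beta> ^ 3 * \<bar>t\<bar> ^ 3"
    using excess_loss_taylor[where k=k and a=a and b=b] unfolding F_def \<beta>_def by auto
  \<comment> \<open>Weighted AM-GM, \<open>2 * u ^ 3 \<le> l * u\<^sup>2 + u ^ 4 / l\<close> for
    \<open>u = sqrt \<beta> * \<bar>t\<bar>\<close>, trades the third absolute moment and the
    half-integer power of \<open>\<beta>\<close> for polynomial terms. Hence 272 = 544 / 2 for each
    law.\<close>
  have cube_le: "544 * sqrt \<beta> ^ 3 * \<bar>t\<bar> ^ 3 \<le> 0 + 0 * t + (272 * l * \<beta>) * t\<^sup>2 + 0 * t ^ 3 + (272 * \<beta>\<^sup>2 / l) * t ^ 4" for t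
  proof -
    define u where "u = sqrt \<beta> * \<bar>t\<bar>"
    have u2: "u\<^sup>2 = \<beta> * t\<^sup>2" using b0 by (simp add: u_def power_mult_distrib)
    have u4: "u ^ 4 = \<beta>\<^sup>2 * t ^ 4"
      using arg_cong[OF u2, of "\<lambda>z. z\<^sup>2"] by (simp add: power_mult_distrib flip: power_mult)
    have "0 \<le> u\<^sup>2 * (l - u)\<^sup>2 / l" using assms by simp
    also have "\<dots> = l * u\<^sup>2 + u ^ 4 / l - 2 * u ^ 3"
      using assms by (simp add: field_simps eval_nat_numeral)
    finally have "2 * u ^ 3 \<le> l * u\<^sup>2 + u ^ 4 / l" by simp
    moreover have "u ^ 3 = sqrt \<beta> ^ 3 * \<bar>t\<bar> ^ 3" by (simp add: u_def power_mult_distrib)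
    ultimately show ?thesis unfolding u2 u4 by simp
  qed
  have one: "\<bar>(\<integral>t. F t \<partial>\<sigma>) - (F 0 + c2)\<bar> \<le> 272 * (l * \<beta> + 3 * \<beta>\<^sup>2 / l)" if s: "standardised \<sigma>" for \<sigma>
  proof -
    have iF: "integrable \<sigma> F" unfolding F_def by (rule standardised_excess_loss_integrable[OF s])
    have eP: "F 0 + c1 * t + c2 * t\<^sup>2 = F 0 + c1 * t + c2 * t\<^sup>2 + 0 * t ^ 3 + 0 * t ^ 4" for t by simp
    have iP: "integrable \<sigma> (\<lambda>t. F 0 + c1 * t + c2 * t\<^sup>2)"
      and vP: "(\<integral>t. F 0 + c1 * t + c2 * t\<^sup>2 \<partial>\<sigma>) = F 0 + c2"
      by (subst eP, use standardised_integral_quartic[OF s, of "F 0" c1 c2 0 0] in simp)+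
    have "(\<integral>t. F t \<partial>\<sigma>) - (F 0 + c2) = (\<integral>t. F t - (F 0 + c1 * t + c2 * t\<^sup>2) \<partial>\<sigma>)"
      unfolding vP[symmetric] using iF iP by (rule Bochner_Integration.integral_diff[symmetric])
    also have "\<bar>\<dots>\<bar> \<le> (\<integral>t. \<bar>F t - (F 0 + c1 * t + c2 * t\<^sup>2)\<bar> \<partial>\<sigma>)" by (rule integral_abs_bound)
    also have "\<dots> \<le> (\<integral>t. 0 + 0 * t + (272 * l * \<beta>) * t\<^sup>2 + 0 * t ^ 3 + (272 * \<beta>\<^sup>2 / l) * t ^ 4 \<partial>\<sigma>)"
      using iF iP standardised_integral_quartic(1)[OF s] order_trans[OF T cube_le]
      by (intro integral_mono integrable_abs Bochner_Integration.integrable_diff)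
    also have "\<dots> = 272 * l * \<beta> + 272 * \<beta>\<^sup>2 / l * (\<integral>t. t ^ 4 \<partial>\<sigma>)"
      by (subst standardised_integral_quartic(2)[OF s]) simp
    also have "\<dots> \<le> 272 * l * \<beta> + 272 * \<beta>\<^sup>2 / l * 3"
      using s assms by (intro add_left_mono mult_left_mono) (auto simp: standardised_def)
    finally show ?thesis by (simp add: algebra_simps)
  qed
  show ?thesis using one[OF assms(1)] one[OF assms(2)] unfolding F_def by linarith
qed

lemma sum_sq_le_sq_sum:
  fixes x :: "'a \<Rightarrow> real"
  assumes "finite A" "\<And>j. j \<in> A \<Longrightarrow> 0 \<le> x j"
  shows "(\<Sum>j\<in>A. (x j)\<^sup>2) \<le> (\<Sum>j\<in>A. x j)\<^sup>2"
  using assms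
proof (induction A rule: finite_induct)
  case (insert a A)
  then have "0 \<le> x a * sum x A" by (intro mult_nonneg_nonneg sum_nonneg) auto
  with insert show ?case by (simp add: power2_sum)
qed simp

context standardised_family
begin

text \<open>\<open>g\<close> sees the family only through \<open>M i\<close> and the measure on
  \<open>J\<close>, so two families differing only at \<open>i\<close> can be compared under one
  outer integral.\<close>

lemma excess_mlpoly_insert:
  fixes c :: "nat \<Rightarrow> nat set \<Rightarrow> real" and k :: nat
  assumes J: "finite J" "i \<notin> J"
  defines "g \<equiv> \<lambda>y. \<integral>t. excess_loss (\<Sum>j<k. (mlpoly J (c j) y + t * mlpoly J (\<lambda>S. c j (insert i S)) y)\<^sup>2) \<partial>M i"
  shows "integrable (PiM J M) g"
    and "(\<integral>x. excess_loss (\<Sum>j<k. (mlpoly (insert i J) (c j) x)\<^sup>2) \<partial>PiM (insert i J) M) = (\<integral>y. g y \<partial>PiM J M)"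
proof -
  interpret Mi: prob_space "M i" by (rule prob_M)
  have "integrable (PiM J M) (\<lambda>y. \<Sum>j<k. (mlpoly J (c j) y)\<^sup>2 + (mlpoly J (\<lambda>S. c j (insert i S)) y)\<^sup>2)"
    using J by (simp add: mlpoly_second_moment)
  then show i: "integrable (PiM J M) g"
  proof (rule Bochner_Integration.integrable_bound)
    show "g \<in> borel_measurable (PiM J M)" unfolding g_def by measurable
    have "0 \<le> g y" for y unfolding g_def by (intro integral_nonneg_AE) (auto intro!: excess_loss_nonneg sum_nonneg)
    moreover have "g y \<le> (\<Sum>j<k. (mlpoly J (c j) y)\<^sup>2 + (mlpoly J (\<lambda>S. c j (insert i S)) y)\<^sup>2)" for y
      unfolding g_def by (rule standardised_excess_loss_integrable[OF std])
    ultimately show "AE y in PiM J M. norm (g y) \<le> norm (\<Sum>j<k. (mlpoly J (c j) y)\<^sup>2 + (mlpoly J (\<lambda>S. c j (insert i S)) y)\<^sup>2)"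
      by (auto intro: order_trans[OF _ abs_ge_self])
  qed
  show "(\<integral>x. excess_loss (\<Sum>j<k. (mlpoly (insert i J) (c j) x)\<^sup>2) \<partial>PiM (insert i J) M) = (\<integral>y. g y \<partial>PiM J M)"
  proof (rule nonneg_product_integral_insert(2)[OF J _ _ _ _ i])
    fix y assume "y \<in> space (PiM J M)"
    show "integrable (M i) (\<lambda>t. excess_loss (\<Sum>j<k. (mlpoly (insert i J) (c j) (y(i := t)))\<^sup>2))"
      unfolding mlpoly_insert_fun_upd[OF J] by (rule standardised_excess_loss_integrable[OF std])
    show "(\<integral>t. excess_loss (\<Sum>j<k. (mlpoly (insert i J) (c j) (y(i := t)))\<^sup>2) \<partial>M i) = g y"
      unfolding mlpoly_insert_fun_upd[OF J] g_def ..
  next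
    show "(\<lambda>x. excess_loss (\<Sum>j<k. (mlpoly (insert i J) (c j) x)\<^sup>2)) \<in> borel_measurable (PiM (insert i J) M)"
      by measurable
  qed (auto intro!: excess_loss_nonneg sum_nonneg)
qed

text \<open>\<open>\<tau>\<close> is the influence of coordinate \<open>i\<close> summed over the
  components, and also the mean of \<open>\<beta>\<close>. The one-dimensional comparison is
  integrated over the other coordinates; its \<open>\<beta>\<^sup>2\<close> term is where
  hypercontractivity enters, costing \<open>9 ^ m = (3 ^ m)\<^sup>2\<close>, while the factor
  \<open>k\<close> comes from bounding the square of a sum of \<open>k\<close> terms.\<close>

lemma lindeberg_step:
  fixes c :: "nat \<Rightarrow> nat set \<Rightarrow> real" and k :: nat
  assumes J: "finite J" "i \<notin> J" and \<nu>: "standardised \<nu>" and l: "0 < l"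
    and deg: "\<And>j S. m < card S \<Longrightarrow> c j S = 0"
  defines "\<tau> \<equiv> (\<Sum>j<k. \<Sum>S\<in>Pow J. (c j (insert i S))\<^sup>2)"
  shows "\<bar>(\<integral>x. excess_loss (\<Sum>j<k. (mlpoly (insert i J) (c j) x)\<^sup>2) \<partial>PiM (insert i J) M)
         - (\<integral>x. excess_loss (\<Sum>j<k. (mlpoly (insert i J) (c j) x)\<^sup>2) \<partial>PiM (insert i J) (M(i := \<nu>)))\<bar>
      \<le> 544 * (l * \<tau> + 3 * real k * 9 ^ m * \<tau>\<^sup>2 / l)"
proof -
  interpret N: standardised_family "M(i := \<nu>)" by unfold_locales (use std \<nu> in auto)
  have PN: "PiM J (M(i := \<nu>)) = PiM J M" using J by (intro PiM_cong) auto
  define a where "a = (\<lambda>j. mlpoly J (c j))"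
  define b where "b = (\<lambda>j. mlpoly J (\<lambda>S. c j (insert i S)))"
  define g where "g = (\<lambda>\<mu> y. \<integral>t. excess_loss (\<Sum>j<k. (a j y + t * b j y)\<^sup>2) \<partial>\<mu>)"
  define \<beta> where "\<beta> = (\<lambda>y. \<Sum>j<k. (b j y)\<^sup>2)"
  define X where "X = (\<lambda>x. excess_loss (\<Sum>j<k. (mlpoly (insert i J) (c j) x)\<^sup>2))"
  have 1: "integrable (PiM J M) (g (M i))" "(\<integral>x. X x \<partial>PiM (insert i J) M) = (\<integral>y. g (M i) y \<partial>PiM J M)"
    unfolding g_def X_def a_def b_def by (rule excess_mlpoly_insert[OF J])+
  have 2: "integrable (PiM J M) (g \<nu>)"
    "(\<integral>x. X x \<partial>PiM (insert i J) (M(i := \<nu>))) = (\<integral>y. g \<nu> y \<partial>PiM J M)"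
    using N.excess_mlpoly_insert[OF J, where k=k and c=c] unfolding g_def X_def a_def b_def PN by simp_all
  have ib: "integrable (PiM J M) \<beta>" "(\<integral>y. \<beta> y \<partial>PiM J M) = \<tau>"
    using J unfolding \<beta>_def b_def \<tau>_def by (simp_all add: mlpoly_second_moment)
  have i4: "integrable (PiM J M) (\<lambda>y. \<Sum>j<k. b j y ^ 4)"
    using J unfolding b_def by (simp add: mlpoly_fourth_moment)
  have b4: "(\<beta> y)\<^sup>2 \<le> real k * (\<Sum>j<k. b j y ^ 4)" for y
    using Cauchy_Schwarz_ineq_sum[of "\<lambda>_. 1" "\<lambda>j. (b j y)\<^sup>2" "{..<k}"]
    unfolding \<beta>_def by (simp flip: power_mult)
  \<comment> \<open>Sets larger than \<open>m\<close> have zero coefficient, so the hypercontractive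
    weights that matter are at most \<open>3 ^ m\<close>.\<close>
  have deg': "(\<Sum>S\<in>Pow J. 3 ^ card S * (c j (insert i S))\<^sup>2) \<le> 3 ^ m * (\<Sum>S\<in>Pow J. (c j (insert i S))\<^sup>2)" for j
    unfolding sum_distrib_left
  proof (rule sum_mono)
    fix S assume "S \<in> Pow J"
    then have S: "finite S" "i \<notin> S" using J finite_subset by auto
    show "3 ^ card S * (c j (insert i S))\<^sup>2 \<le> 3 ^ m * (c j (insert i S))\<^sup>2"
    proof (cases "card S \<le> m")
      case True
      then show ?thesis by (intro mult_right_mono power_increasing) auto
    next
      case False
      then show ?thesis using deg[of "insert i S" j] S by simp
    qed
  qed
  have "(\<integral>y. (\<Sum>j<k. b j y ^ 4) \<partial>PiM J M) = (\<Sum>j<k. \<integral>y. b j y ^ 4 \<partial>PiM J M)"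
    using J unfolding b_def by (simp add: mlpoly_fourth_moment)
  also have "\<dots> \<le> (\<Sum>j<k. (3 ^ m * (\<Sum>S\<in>Pow J. (c j (insert i S))\<^sup>2))\<^sup>2)"
  proof (rule sum_mono)
    fix j
    have "(\<integral>y. b j y ^ 4 \<partial>PiM J M) \<le> (\<Sum>S\<in>Pow J. 3 ^ card S * (c j (insert i S))\<^sup>2)\<^sup>2"
      unfolding b_def by (rule mlpoly_fourth_moment[OF J(1)])
    also have "\<dots> \<le> (3 ^ m * (\<Sum>S\<in>Pow J. (c j (insert i S))\<^sup>2))\<^sup>2"
      by (intro power_mono deg' sum_nonneg) auto
    finally show "(\<integral>y. b j y ^ 4 \<partial>PiM J M) \<le> (3 ^ m * (\<Sum>S\<in>Pow J. (c j (insert i S))\<^sup>2))\<^sup>2" .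
  qed
  also have "\<dots> \<le> (\<Sum>j<k. 3 ^ m * (\<Sum>S\<in>Pow J. (c j (insert i S))\<^sup>2))\<^sup>2"
    by (rule sum_sq_le_sq_sum) (auto intro!: mult_nonneg_nonneg sum_nonneg)
  also have "\<dots> = 9 ^ m * \<tau>\<^sup>2"
    unfolding \<tau>_def sum_distrib_left[symmetric] power_mult_distrib
    by (simp add: power_mult[symmetric] power2_eq_square power_mult_distrib[symmetric])
  finally have v4: "(\<integral>y. (\<Sum>j<k. b j y ^ 4) \<partial>PiM J M) \<le> 9 ^ m * \<tau>\<^sup>2" .
  have bound: "\<bar>g (M i) y - g \<nu> y\<bar> \<le> 544 * (l * \<beta> y + 3 * (real k * (\<Sum>j<k. b j y ^ 4)) / l)" for y
  proof -
    have "\<bar>g (M i) y - g \<nu> y\<bar> \<le> 544 * (l * \<beta> y + 3 * (\<beta> y)\<^sup>2 / l)"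
      unfolding g_def \<beta>_def by (rule standardised_excess_loss_diff[OF std \<nu> l])
    also have "\<dots> \<le> 544 * (l * \<beta> y + 3 * (real k * (\<Sum>j<k. b j y ^ 4)) / l)"
      using b4[of y] l by (intro mult_left_mono add_left_mono divide_right_mono) auto
    finally show ?thesis .
  qed
  have "(\<integral>x. X x \<partial>PiM (insert i J) M) - (\<integral>x. X x \<partial>PiM (insert i J) (M(i := \<nu>)))
      = (\<integral>y. g (M i) y - g \<nu> y \<partial>PiM J M)"
    unfolding 1(2) 2(2) using 1(1) 2(1) by simp
  also have "\<bar>\<dots>\<bar> \<le> (\<integral>y. \<bar>g (M i) y - g \<nu> y\<bar> \<partial>PiM J M)" by (rule integral_abs_bound)
  also have "\<dots> \<le> (\<integral>y. 544 * (l * \<beta> y + 3 * (real k * (\<Sum>j<k. b j y ^ 4)) / l) \<partial>PiM J M)"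
    by (intro integral_mono bound) (use 1(1) 2(1) ib(1) i4 in auto)
  also have "\<dots> = 544 * (l * \<tau> + 3 * (real k * (\<integral>y. (\<Sum>j<k. b j y ^ 4) \<partial>PiM J M)) / l)"
    using ib i4 by simp
  also have "\<dots> \<le> 544 * (l * \<tau> + 3 * (real k * (9 ^ m * \<tau>\<^sup>2)) / l)"
    using v4 l by (intro mult_left_mono add_left_mono divide_right_mono) auto
  finally show ?thesis unfolding X_def by (simp add: mult.assoc)
qed

end

text \<open>The coordinates change law one by one. Step \<open>p\<close> costs a multiple of
  \<open>l * \<tau> p\<close> because \<open>\<tau> p \<le> l\<^sup>2\<close>, and the influences of
  a polynomial of degree at most \<open>m\<close> and total weight at most 1 add up to at most
  \<open>m\<close>.\<close>

lemma lindeberg: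
  fixes c :: "nat \<Rightarrow> nat set \<Rightarrow> real"
  assumes \<mu>: "standardised \<mu>" and \<nu>: "standardised \<nu>" and l: "0 < l"
    and deg: "\<And>j S. m < card S \<Longrightarrow> c j S = 0"
    and inf: "\<And>i. i < n \<Longrightarrow> (\<Sum>j<k. \<Sum>S\<in>{S. S \<subseteq> {..<n} \<and> i \<in> S}. (c j S)\<^sup>2) \<le> l\<^sup>2"
    and total: "(\<Sum>j<k. \<Sum>S\<in>Pow {..<n}. (c j S)\<^sup>2) \<le> 1"
  shows "\<bar>(\<integral>x. excess_loss (\<Sum>j<k. (mlpoly {..<n} (c j) x)\<^sup>2) \<partial>PiM {..<n} (\<lambda>_. \<mu>))
         - (\<integral>x. excess_loss (\<Sum>j<k. (mlpoly {..<n} (c j) x)\<^sup>2) \<partial>PiM {..<n} (\<lambda>_. \<nu>))\<bar>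
      \<le> 544 * (1 + 3 * real k * 9 ^ m) * real m * l"
proof -
  define E where "E = (\<lambda>M. \<integral>x. excess_loss (\<Sum>j<k. (mlpoly {..<n} (c j) x)\<^sup>2) \<partial>PiM {..<n} M)"
  define hyb where "hyb = (\<lambda>p i. if i < (p::nat) then \<nu> else \<mu>)"
  define \<tau> where "\<tau> = (\<lambda>i. \<Sum>j<k. \<Sum>S\<in>{S. S \<subseteq> {..<n} \<and> i \<in> S}. (c j S)\<^sup>2)"
  define C where "C = 544 * (1 + 3 * real k * 9 ^ m)"
  have step: "\<bar>E (hyb p) - E (hyb (Suc p))\<bar> \<le> C * l * \<tau> p" if p: "p < n" for p
  proof -
    interpret standardised_family "hyb p" by unfold_locales (use \<mu> \<nu> in \<open>auto simp: hyb_def\<close>)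
    have ins: "insert p ({..<n} - {p}) = {..<n}" using p by auto
    have h: "(hyb p)(p := \<nu>) = hyb (Suc p)" by (auto simp: hyb_def fun_eq_iff)
    have t: "(\<Sum>j<k. \<Sum>S\<in>Pow ({..<n} - {p}). (c j (insert p S))\<^sup>2) = \<tau> p"
      unfolding \<tau>_def
    proof (rule sum.cong[OF refl], rule sum.reindex_bij_witness[of _ "\<lambda>S. S - {p}" "insert p"])
    qed (use p in auto)
    have "\<bar>E (hyb p) - E (hyb (Suc p))\<bar> \<le> 544 * (l * \<tau> p + 3 * real k * 9 ^ m * (\<tau> p)\<^sup>2 / l)"
      using lindeberg_step[where J="{..<n} - {p}" and i=p and k=k and c=c and m=m, OF _ _ \<nu> l deg]
      unfolding ins h t E_def by simp
    also have "\<dots> \<le> 544 * (l * \<tau> p + 3 * real k * 9 ^ m * (l * \<tau> p))"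
    proof -
      have t0: "0 \<le> \<tau> p" unfolding \<tau>_def by (intro sum_nonneg) auto
      have "(\<tau> p)\<^sup>2 \<le> l\<^sup>2 * \<tau> p"
        using mult_right_mono[OF inf[OF p, folded \<tau>_def] t0] by (simp add: power2_eq_square \<tau>_def)
      then have "(\<tau> p)\<^sup>2 / l \<le> l * \<tau> p" using l by (simp add: field_simps power2_eq_square)
      then have "3 * real k * 9 ^ m * ((\<tau> p)\<^sup>2 / l) \<le> 3 * real k * 9 ^ m * (l * \<tau> p)"
        by (intro mult_left_mono) auto
      then show ?thesis by simp
    qed
    finally show ?thesis by (simp add: C_def algebra_simps)
  qed
  have tele: "\<bar>E (hyb 0) - E (hyb p)\<bar> \<le> C * l * (\<Sum>i<p. \<tau> i)" if "p \<le> n" for p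
    using that
  proof (induction p)
    case (Suc p)
    have "\<bar>E (hyb 0) - E (hyb (Suc p))\<bar> \<le> \<bar>E (hyb 0) - E (hyb p)\<bar> + \<bar>E (hyb p) - E (hyb (Suc p))\<bar>" by simp
    also have "\<dots> \<le> C * l * (\<Sum>i<p. \<tau> i) + C * l * \<tau> p"
      using Suc step[of p] by (intro add_mono) auto
    finally show ?case by (simp add: algebra_simps)
  qed simp
  \<comment> \<open>Double counting: each \<open>S\<close> occurs once for every \<open>i\<close> in
    it.\<close>
  have "(\<Sum>i<n. \<tau> i) = (\<Sum>j<k. \<Sum>S\<in>Pow {..<n}. real (card S) * (c j S)\<^sup>2)"
  proof -
    have "(\<Sum>i<n. \<tau> i) = (\<Sum>j<k. \<Sum>i<n. \<Sum>S\<in>{S. S \<subseteq> {..<n} \<and> i \<in> S}. (c j S)\<^sup>2)"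
      unfolding \<tau>_def by (rule sum.swap)
    also have "\<dots> = (\<Sum>j<k. \<Sum>S\<in>Pow {..<n}. real (card S) * (c j S)\<^sup>2)"
    proof (rule sum.cong[OF refl])
      fix j
      have "(\<Sum>i<n. \<Sum>S\<in>{S. S \<subseteq> {..<n} \<and> i \<in> S}. (c j S)\<^sup>2) = (\<Sum>i<n. \<Sum>S\<in>{S \<in> Pow {..<n}. i \<in> S}. (c j S)\<^sup>2)"
        by (intro sum.cong) auto
      also have "\<dots> = (\<Sum>S\<in>Pow {..<n}. \<Sum>i\<in>{i \<in> {..<n}. i \<in> S}. (c j S)\<^sup>2)"
        by (rule sum.swap_restrict) auto
      also have "\<dots> = (\<Sum>S\<in>Pow {..<n}. real (card S) * (c j S)\<^sup>2)"
      proof (rule sum.cong[OF refl])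
        fix S :: "nat set" assume "S \<in> Pow {..<n}"
        then have "{i \<in> {..<n}. i \<in> S} = S" by auto
        then show "(\<Sum>i\<in>{i \<in> {..<n}. i \<in> S}. (c j S)\<^sup>2) = real (card S) * (c j S)\<^sup>2" by simp
      qed
      finally show "(\<Sum>i<n. \<Sum>S\<in>{S. S \<subseteq> {..<n} \<and> i \<in> S}. (c j S)\<^sup>2) = (\<Sum>S\<in>Pow {..<n}. real (card S) * (c j S)\<^sup>2)" .
    qed
    finally show ?thesis .
  qed
  also have "\<dots> \<le> (\<Sum>j<k. \<Sum>S\<in>Pow {..<n}. real m * (c j S)\<^sup>2)"
  proof (intro sum_mono)
    fix j S
    show "real (card S) * (c j S)\<^sup>2 \<le> real m * (c j S)\<^sup>2"
      using deg[of S j] by (cases "m < card S") (auto intro!: mult_right_mono)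
  qed
  also have "\<dots> = real m * (\<Sum>j<k. \<Sum>S\<in>Pow {..<n}. (c j S)\<^sup>2)" by (simp add: sum_distrib_left)
  also have "\<dots> \<le> real m * 1" using total by (intro mult_left_mono) auto
  finally have "(\<Sum>i<n. \<tau> i) \<le> real m" by simp
  then have "C * l * (\<Sum>i<n. \<tau> i) \<le> C * l * real m" using l by (intro mult_left_mono) (auto simp: C_def)
  moreover have "E (hyb 0) = E (\<lambda>_. \<mu>)" by (simp add: hyb_def)
  \<comment> \<open>\<open>hyb n\<close> agrees with the constant family \<open>\<nu>\<close> only
    below \<open>n\<close>, which is all that the product over \<open>{..<n}\<close> sees.\<close>
  moreover have "E (hyb n) = E (\<lambda>_. \<nu>)" unfolding E_def
    by (intro arg_cong2[of _ _ _ _ "integral\<^sup>L"] PiM_cong) (auto simp: hyb_def)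
  ultimately show ?thesis using tele[of n] unfolding E_def C_def by (simp add: mult.commute mult.left_commute)
qed

section \<open>Fourier analysis on the cube\<close>

lemma finite_cube [simp]: "finite (cube n)"
  by (simp add: cube_def finite_PiE)

lemma card_cube: "card (cube n) = 2 ^ n"
  by (simp add: cube_def card_PiE numeral_2_eq_2)

lemma cube_mem: "x \<in> cube n \<Longrightarrow> i < n \<Longrightarrow> x i = -1 \<or> x i = 1"
  by (auto simp: cube_def PiE_def Pi_def)

text \<open>The conditional probability of \<open>y\<close> given \<open>x\<close> at correlation
  \<open>r\<close>; the weight in \<open>bool_stab\<close> is this divided by
  \<open>2 ^ n\<close>.\<close>

definition noise_kernel :: "nat \<Rightarrow> real \<Rightarrow> (nat \<Rightarrow> real) \<Rightarrow> (nat \<Rightarrow> real) \<Rightarrow> real" where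
  "noise_kernel n r x y = (\<Prod>i<n. if y i = x i then (1 + r) / 2 else (1 - r) / 2)"

text \<open>On signs each factor equals \<open>(1 + r * x i * y i) / 2\<close>, and the product over
  \<open>i\<close> is expanded over subsets.\<close>

lemma noise_kernel_expand:
  assumes "x \<in> cube n" "y \<in> cube n"
  shows "noise_kernel n r x y = (\<Sum>S\<in>Pow {..<n}. r ^ card S * (chi S x * chi S y)) / 2 ^ n"
proof -
  have "noise_kernel n r x y = (\<Prod>i<n. (r * x i * y i + 1) / 2)"
    unfolding noise_kernel_def
  proof (rule prod.cong[OF refl])
    fix i assume "i \<in> {..<n}"
    then show "(if y i = x i then (1 + r) / 2 else (1 - r) / 2) = (r * x i * y i + 1) / 2"
      using cube_mem[OF assms(1), of i] cube_mem[OF assms(2), of i] by auto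
  qed
  also have "\<dots> = (\<Prod>i<n. r * x i * y i + 1) / 2 ^ n" by (simp add: prod_dividef)
  also have "(\<Prod>i<n. r * x i * y i + 1) = (\<Sum>S\<in>Pow {..<n}. r ^ card S * (chi S x * chi S y))"
    by (simp add: prod_add chi_def prod.distrib mult.assoc)
  finally show ?thesis .
qed

lemma noise_kernel_nonneg:
  "0 \<le> r \<Longrightarrow> r \<le> 1 \<Longrightarrow> 0 \<le> noise_kernel n r x y"
  unfolding noise_kernel_def by (intro prod_nonneg) auto

lemma noise_kernel_sum:
  assumes "x \<in> cube n"
  shows "(\<Sum>y\<in>cube n. noise_kernel n r x y) = 1"
proof -
  have "(\<Sum>y\<in>cube n. noise_kernel n r x y)
      = (\<Prod>i<n. \<Sum>v\<in>{-1, 1}. if v = x i then (1 + r) / 2 else (1 - r) / 2)"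
    unfolding noise_kernel_def cube_def by (subst prod_sum_PiE) auto
  also have "\<dots> = 1"
  proof (intro prod.neutral ballI)
    fix i assume "i \<in> {..<n}"
    then show "(\<Sum>v\<in>{-1, 1}. if v = x i then (1 + r) / 2 else (1 - r) / 2) = 1"
      using cube_mem[OF assms, of i] by (auto simp: field_simps)
  qed
  finally show ?thesis .
qed

text \<open>Once the kernel is expanded, the double sum for each \<open>S\<close> and
  \<open>j\<close> is a product of two equal sums; what remains is reordering. As an identity in
  \<open>r\<close> it covers negative correlations.\<close>

lemma bool_stab_fourier:
  "bool_stab n k r f = (\<Sum>S\<in>Pow {..<n}. r ^ card S * (\<Sum>j<k. (fourier n (\<lambda>x. f x j) S)\<^sup>2))"
proof -
  have sq: "(\<Sum>x\<in>cube n. \<Sum>y\<in>cube n. (f x j * chi S x) * (f y j * chi S y)) / (2 ^ n * 2 ^ n)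
      = (fourier n (\<lambda>x. f x j) S)\<^sup>2" for j S
    unfolding fourier_def power2_eq_square by (simp add: sum_product)
  have "bool_stab n k r f = (\<Sum>x\<in>cube n. \<Sum>y\<in>cube n. \<Sum>S\<in>Pow {..<n}. \<Sum>j<k.
      r ^ card S * ((f x j * chi S x) * (f y j * chi S y)) / (2 ^ n * 2 ^ n))"
    unfolding bool_stab_def
  proof (intro sum.cong refl)
    fix x y assume xy: "x \<in> cube n" "y \<in> cube n"
    have "(\<Prod>i<n. if y i = x i then (1 + r) / 2 else (1 - r) / 2) / 2 ^ n * inner_k k (f x) (f y)
       = (\<Sum>S\<in>Pow {..<n}. r ^ card S * (chi S x * chi S y)) * (\<Sum>j<k. f x j * f y j) / (2 ^ n * 2 ^ n)"
      using noise_kernel_expand[OF xy, of r] by (simp add: noise_kernel_def inner_k_def)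
    also have "\<dots> = (\<Sum>S\<in>Pow {..<n}. \<Sum>j<k.
      r ^ card S * ((f x j * chi S x) * (f y j * chi S y)) / (2 ^ n * 2 ^ n))"
      unfolding sum_product sum_divide_distrib by (intro sum.cong refl) (simp add: ac_simps)
    finally show "(\<Prod>i<n. if y i = x i then (1 + r) / 2 else (1 - r) / 2) / 2 ^ n * inner_k k (f x) (f y)
       = (\<Sum>S\<in>Pow {..<n}. \<Sum>j<k. r ^ card S * ((f x j * chi S x) * (f y j * chi S y)) / (2 ^ n * 2 ^ n))" .
  qed
  also have "\<dots> = (\<Sum>x\<in>cube n. \<Sum>S\<in>Pow {..<n}. \<Sum>y\<in>cube n. \<Sum>j<k.
      r ^ card S * ((f x j * chi S x) * (f y j * chi S y)) / (2 ^ n * 2 ^ n))"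
    by (intro sum.cong[OF refl] sum.swap)
  also have "\<dots> = (\<Sum>S\<in>Pow {..<n}. \<Sum>x\<in>cube n. \<Sum>j<k. \<Sum>y\<in>cube n.
      r ^ card S * ((f x j * chi S x) * (f y j * chi S y)) / (2 ^ n * 2 ^ n))"
    by (subst sum.swap) (intro sum.cong[OF refl] sum.swap)
  also have "\<dots> = (\<Sum>S\<in>Pow {..<n}. \<Sum>j<k. \<Sum>x\<in>cube n. \<Sum>y\<in>cube n.
      r ^ card S * ((f x j * chi S x) * (f y j * chi S y)) / (2 ^ n * 2 ^ n))"
    by (intro sum.cong[OF refl] sum.swap)
  also have "\<dots> = (\<Sum>S\<in>Pow {..<n}. \<Sum>j<k. r ^ card S * (fourier n (\<lambda>x. f x j) S)\<^sup>2)"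
    unfolding sq[symmetric] by (simp add: sum_distrib_left sum_divide_distrib)
  finally show ?thesis by (simp add: sum_distrib_left)
qed

definition noise_op :: "nat \<Rightarrow> real \<Rightarrow> ((nat \<Rightarrow> real) \<Rightarrow> real) \<Rightarrow> (nat \<Rightarrow> real) \<Rightarrow> real" where
  "noise_op n r g x = (\<Sum>y\<in>cube n. noise_kernel n r x y * g y)"

text \<open>Links two views of noise: the kernel form averages and so preserves the ball, while this
  form is a polynomial with damped high degrees.\<close>

lemma noise_op_eq_mlpoly:
  assumes "x \<in> cube n"
  shows "noise_op n r g x = mlpoly {..<n} (\<lambda>S. r ^ card S * fourier n g S) x"
proof -
  have "noise_op n r g x = (\<Sum>y\<in>cube n. \<Sum>S\<in>Pow {..<n}. r ^ card S * (g y * chi S y) / 2 ^ n * chi S x)"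
    unfolding noise_op_def
  proof (rule sum.cong[OF refl])
    fix y assume y: "y \<in> cube n"
    show "noise_kernel n r x y * g y = (\<Sum>S\<in>Pow {..<n}. r ^ card S * (g y * chi S y) / 2 ^ n * chi S x)"
      unfolding noise_kernel_expand[OF assms y] sum_divide_distrib sum_distrib_right
      by (intro sum.cong refl) (simp add: ac_simps)
  qed
  also have "\<dots> = (\<Sum>S\<in>Pow {..<n}. \<Sum>y\<in>cube n. r ^ card S * (g y * chi S y) / 2 ^ n * chi S x)"
    by (rule sum.swap)
  also have "\<dots> = mlpoly {..<n} (\<lambda>S. r ^ card S * fourier n g S) x"
    unfolding mlpoly_def fourier_def
    by (intro sum.cong refl) (simp add: sum_distrib_left sum_distrib_right sum_divide_distrib)
  finally show ?thesis .
qed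

text \<open>The kernel averages with probability weights and the ball is convex; convexity is
  applied as Jensen for the square in each component.\<close>

lemma noise_op_in_ball:
  assumes x: "x \<in> cube n" and r: "0 \<le> r" "r \<le> 1" and f: "\<And>y. y \<in> cube n \<Longrightarrow> in_ball_k k (f y)"
  shows "(\<Sum>j<k. (noise_op n r (\<lambda>y. f y j) x)\<^sup>2) \<le> 1"
proof -
  define K where "K = noise_kernel n r x"
  have K: "0 \<le> K y" for y unfolding K_def by (rule noise_kernel_nonneg[OF r])
  have K1: "(\<Sum>y\<in>cube n. K y) = 1" unfolding K_def by (rule noise_kernel_sum[OF x])
  have jensen: "(\<Sum>y\<in>cube n. K y * g y)\<^sup>2 \<le> (\<Sum>y\<in>cube n. K y * (g y)\<^sup>2)" for g :: "_ \<Rightarrow> real"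
  proof -
    \<comment> \<open>Writing the weight as \<open>sqrt (K y) * sqrt (K y)\<close> turns Jensen into
      Cauchy-Schwarz.\<close>
    have "(\<Sum>y\<in>cube n. K y * g y)\<^sup>2 = (\<Sum>y\<in>cube n. sqrt (K y) * (sqrt (K y) * g y))\<^sup>2"
      using K by (simp flip: mult.assoc)
    also have "\<dots> \<le> (\<Sum>y\<in>cube n. (sqrt (K y))\<^sup>2) * (\<Sum>y\<in>cube n. (sqrt (K y) * g y)\<^sup>2)"
      by (rule Cauchy_Schwarz_ineq_sum)
    finally show ?thesis using K K1 by (simp add: power_mult_distrib)
  qed
  have "(\<Sum>j<k. (noise_op n r (\<lambda>y. f y j) x)\<^sup>2) \<le> (\<Sum>j<k. \<Sum>y\<in>cube n. K y * (f y j)\<^sup>2)"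
    unfolding noise_op_def K_def[symmetric] by (intro sum_mono jensen)
  also have "\<dots> = (\<Sum>y\<in>cube n. K y * (\<Sum>j<k. (f y j)\<^sup>2))"
    by (subst sum.swap) (simp add: sum_distrib_left)
  also have "\<dots> \<le> (\<Sum>y\<in>cube n. K y * 1)"
    using f K by (intro sum_mono mult_left_mono) (auto simp: in_ball_k_def)
  finally show ?thesis using K1 by simp
qed

lemma chi_orthogonal:
  assumes "S \<subseteq> {..<n}" "T \<subseteq> {..<n}"
  shows "(\<Sum>x\<in>cube n. chi S x * chi T x) = (if S = T then 2 ^ n else 0)"
proof -
  \<comment> \<open>Factors 1 outside \<open>S\<close> make all products run over
    \<open>{..<n}\<close>, so that the sum over the cube factors into coordinates.\<close>
  have ext: "chi S x = (\<Prod>i<n. if i \<in> S then x i else 1)" if "S \<subseteq> {..<n}" for S x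
    unfolding chi_def using that by (simp add: prod.If_cases Int_absorb1)
  have "(\<Sum>x\<in>cube n. chi S x * chi T x)
      = (\<Sum>x\<in>cube n. \<Prod>i<n. (if i \<in> S then x i else 1) * (if i \<in> T then x i else 1))"
    using assms by (simp add: ext prod.distrib)
  also have "\<dots> = (\<Prod>i<n. \<Sum>v\<in>{-1, 1}. (if i \<in> S then v else 1) * (if i \<in> T then v else 1))"
    unfolding cube_def by (subst prod_sum_PiE) auto
  also have "\<dots> = (\<Prod>i<n. if (i \<in> S) = (i \<in> T) then 2 else 0)"
    by (intro prod.cong) auto
  also have "\<dots> = (if S = T then 2 ^ n else 0)"
  proof (cases "S = T")
    case False
    then obtain i where "i < n" "(i \<in> S) \<noteq> (i \<in> T)" using assms by auto
    then have "(\<Prod>i<n. if (i \<in> S) = (i \<in> T) then 2 else 0 :: real) = 0"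
      by (intro prod_zero) auto
    then show ?thesis using False by simp
  qed simp
  finally show ?thesis .
qed

lemma mlpoly_cube_parseval:
  "(\<Sum>x\<in>cube n. (mlpoly {..<n} c x)\<^sup>2) = 2 ^ n * (\<Sum>S\<in>Pow {..<n}. (c S)\<^sup>2)"
proof -
  have "(\<Sum>x\<in>cube n. (mlpoly {..<n} c x)\<^sup>2)
      = (\<Sum>x\<in>cube n. \<Sum>S\<in>Pow {..<n}. \<Sum>T\<in>Pow {..<n}. c S * c T * (chi S x * chi T x))"
    unfolding mlpoly_def power2_eq_square sum_product by (simp add: ac_simps)
  also have "\<dots> = (\<Sum>S\<in>Pow {..<n}. \<Sum>T\<in>Pow {..<n}. c S * c T * (\<Sum>x\<in>cube n. chi S x * chi T x))"
    by (subst sum.swap, intro sum.cong[OF refl], subst sum.swap) (simp add: sum_distrib_left)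
  also have "\<dots> = (\<Sum>S\<in>Pow {..<n}. \<Sum>T\<in>Pow {..<n}. if S = T then 2 ^ n * (c S)\<^sup>2 else 0)"
    by (intro sum.cong refl) (auto simp: chi_orthogonal power2_eq_square)
  also have "\<dots> = 2 ^ n * (\<Sum>S\<in>Pow {..<n}. (c S)\<^sup>2)" by (simp add: sum_distrib_left)
  finally show ?thesis .
qed

text \<open>Bessel's inequality, read off from the nonnegative squared distance between
  \<open>g\<close> and its own Fourier polynomial.\<close>

lemma fourier_bessel: "(\<Sum>S\<in>Pow {..<n}. (fourier n g S)\<^sup>2) \<le> (\<Sum>x\<in>cube n. (g x)\<^sup>2) / 2 ^ n"
proof -
  define p where "p = mlpoly {..<n} (fourier n g)"
  have "(\<Sum>x\<in>cube n. g x * p x) = (\<Sum>x\<in>cube n. \<Sum>S\<in>Pow {..<n}. fourier n g S * (g x * chi S x))"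
    unfolding p_def mlpoly_def sum_distrib_left by (simp add: ac_simps)
  also have "\<dots> = (\<Sum>S\<in>Pow {..<n}. fourier n g S * (\<Sum>x\<in>cube n. g x * chi S x))"
    by (subst sum.swap) (simp add: sum_distrib_left)
  also have "\<dots> = 2 ^ n * (\<Sum>S\<in>Pow {..<n}. (fourier n g S)\<^sup>2)"
  proof -
    have "(\<Sum>x\<in>cube n. g x * chi S x) = 2 ^ n * fourier n g S" for S by (simp add: fourier_def)
    then show ?thesis by (simp add: sum_distrib_left power2_eq_square ac_simps)
  qed
  finally have gp: "(\<Sum>x\<in>cube n. g x * p x) = 2 ^ n * (\<Sum>S\<in>Pow {..<n}. (fourier n g S)\<^sup>2)" .
  have "0 \<le> (\<Sum>x\<in>cube n. (g x - p x)\<^sup>2)" by (intro sum_nonneg) auto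
  also have "\<dots> = (\<Sum>x\<in>cube n. (g x)\<^sup>2) + (\<Sum>x\<in>cube n. (p x)\<^sup>2) - 2 * (\<Sum>x\<in>cube n. g x * p x)"
    by (simp add: power2_diff sum.distrib sum_subtractf sum_distrib_left mult.assoc)
  finally have "2 ^ n * (\<Sum>S\<in>Pow {..<n}. (fourier n g S)\<^sup>2) \<le> (\<Sum>x\<in>cube n. (g x)\<^sup>2)"
    using gp mlpoly_cube_parseval[of n "fourier n g"] by (simp add: p_def)
  then show ?thesis by (simp add: field_simps)
qed

lemma ball_fourier_total:
  assumes "\<And>x. x \<in> cube n \<Longrightarrow> in_ball_k k (f x)"
  shows "(\<Sum>j<k. \<Sum>S\<in>Pow {..<n}. (fourier n (\<lambda>x. f x j) S)\<^sup>2) \<le> 1"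
proof -
  have "(\<Sum>j<k. \<Sum>S\<in>Pow {..<n}. (fourier n (\<lambda>x. f x j) S)\<^sup>2) \<le> (\<Sum>j<k. (\<Sum>x\<in>cube n. (f x j)\<^sup>2) / 2 ^ n)"
    by (intro sum_mono fourier_bessel)
  also have "\<dots> = (\<Sum>x\<in>cube n. \<Sum>j<k. (f x j)\<^sup>2) / 2 ^ n"
    by (subst sum.swap) (simp add: sum_divide_distrib)
  also have "\<dots> \<le> (\<Sum>x\<in>cube n. 1) / 2 ^ n"
    using assms by (intro divide_right_mono sum_mono) (auto simp: in_ball_k_def)
  also have "\<dots> = 1" by (simp add: card_cube)
  finally show ?thesis .
qed

text \<open>The coefficients of the polynomial \<open>p\<close> of the overview. Partially applied
  to \<open>f\<close>, this is the family \<open>c j S\<close> to which \<open>lindeberg\<close> and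
  \<open>gauss_stab_ge_Fstar\<close> are applied.\<close>

definition trunc_coeff :: "nat \<Rightarrow> nat \<Rightarrow> real \<Rightarrow> ((nat \<Rightarrow> real) \<Rightarrow> nat \<Rightarrow> real) \<Rightarrow> nat \<Rightarrow> nat set \<Rightarrow> real" where
  "trunc_coeff n m r f j S = (if card S \<le> m then r ^ card S * fourier n (\<lambda>x. f x j) S else 0)"

lemma trunc_coeff_sq_le:
  assumes "0 \<le> r" "r \<le> 1"
  shows "(trunc_coeff n m r f j S)\<^sup>2 \<le> (fourier n (\<lambda>x. f x j) S)\<^sup>2"
proof -
  have "(r ^ card S)\<^sup>2 \<le> 1" using assms by (simp add: power_le_one)
  then show ?thesis
    using mult_right_mono[of "(r ^ card S)\<^sup>2" 1 "(fourier n (\<lambda>x. f x j) S)\<^sup>2"]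
    by (auto simp: trunc_coeff_def power_mult_distrib)
qed

text \<open>The distance of \<open>p\<close> from the ball is at most its distance from the
  ball-valued noise average, that is, the norm of the discarded part. By Parseval the mean square of
  that part is at most \<open>(r ^ m)\<^sup>2\<close>, since it lives in degrees above
  \<open>m\<close> and \<open>f\<close> has total Fourier weight at most 1.\<close>

lemma cube_excess_loss:
  assumes f: "\<And>x. x \<in> cube n \<Longrightarrow> in_ball_k k (f x)" and r: "0 \<le> r" "r \<le> 1"
  shows "(\<Sum>x\<in>cube n. excess_loss (\<Sum>j<k. (mlpoly {..<n} (trunc_coeff n m r f j) x)\<^sup>2)) / 2 ^ n \<le> 16 * (r ^ m)\<^sup>2"
proof -
  define c where "c = trunc_coeff n m r f"
  define F where "F = (\<lambda>j. fourier n (\<lambda>x. f x j))"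
  \<comment> \<open>Coefficients of the discarded high-degree part.\<close>
  define d where "d = (\<lambda>j S. r ^ card S * F j S - c j S)"
  have pt: "excess_loss (\<Sum>j<k. (mlpoly {..<n} (c j) x)\<^sup>2) \<le> 16 * (\<Sum>j<k. (mlpoly {..<n} (d j) x)\<^sup>2)"
    if x: "x \<in> cube n" for x
  proof -
    define p where "p = (\<lambda>j. mlpoly {..<n} (c j) x)"
    define v where "v = (\<lambda>j. noise_op n r (\<lambda>y. f y j) x)"
    have vp: "v j - p j = mlpoly {..<n} (d j) x" for j
      unfolding v_def p_def noise_op_eq_mlpoly[OF x] by (simp add: mlpoly_def d_def F_def left_diff_distrib sum_subtractf)
    have v1: "L2_set v {..<k} \<le> 1"
      using noise_op_in_ball[OF x r f] by (simp add: L2_set_def v_def)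
    have "L2_set (\<lambda>j. v j + (p j - v j)) {..<k} \<le> L2_set v {..<k} + L2_set (\<lambda>j. p j - v j) {..<k}"
      by (rule L2_set_triangle_ineq)
    then have "L2_set p {..<k} - 1 \<le> L2_set (\<lambda>j. p j - v j) {..<k}" using v1 by simp
    then have "(max 0 (L2_set p {..<k} - 1))\<^sup>2 \<le> (L2_set (\<lambda>j. p j - v j) {..<k})\<^sup>2"
      by (intro power_mono) auto
    also have "\<dots> = (\<Sum>j<k. (mlpoly {..<n} (d j) x)\<^sup>2)"
      unfolding vp[symmetric] by (simp add: L2_set_def sum_nonneg power2_commute)
    finally have "16 * (max 0 (L2_set p {..<k} - 1))\<^sup>2 \<le> 16 * (\<Sum>j<k. (mlpoly {..<n} (d j) x)\<^sup>2)" by simp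
    moreover have "(L2_set p {..<k})\<^sup>2 = (\<Sum>j<k. (mlpoly {..<n} (c j) x)\<^sup>2)"
      by (simp add: L2_set_def sum_nonneg p_def)
    ultimately show ?thesis using excess_loss_upper[of "L2_set p {..<k}"] by simp
  qed
  have dle: "(d j S)\<^sup>2 \<le> (r ^ m)\<^sup>2 * (F j S)\<^sup>2" for j S
  proof (cases "card S \<le> m")
    case True then show ?thesis by (simp add: d_def c_def F_def trunc_coeff_def)
  next
    case False
    then have "r ^ card S \<le> r ^ m" using r by (intro power_decreasing) auto
    then have "(r ^ card S)\<^sup>2 \<le> (r ^ m)\<^sup>2" using r by (intro power_mono) auto
    then show ?thesis using False
      by (auto simp: d_def c_def F_def trunc_coeff_def power_mult_distrib intro!: mult_right_mono)
  qed
  have "(\<Sum>x\<in>cube n. excess_loss (\<Sum>j<k. (mlpoly {..<n} (c j) x)\<^sup>2))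
      \<le> (\<Sum>x\<in>cube n. 16 * (\<Sum>j<k. (mlpoly {..<n} (d j) x)\<^sup>2))"
    by (intro sum_mono pt)
  also have "\<dots> = 16 * (\<Sum>j<k. \<Sum>x\<in>cube n. (mlpoly {..<n} (d j) x)\<^sup>2)"
    unfolding sum_distrib_left[symmetric] by (subst sum.swap) simp
  also have "\<dots> = 16 * 2 ^ n * (\<Sum>j<k. \<Sum>S\<in>Pow {..<n}. (d j S)\<^sup>2)"
    by (simp add: mlpoly_cube_parseval sum_distrib_left mult.assoc)
  also have "\<dots> \<le> 16 * 2 ^ n * (\<Sum>j<k. \<Sum>S\<in>Pow {..<n}. (r ^ m)\<^sup>2 * (F j S)\<^sup>2)"
    by (intro mult_left_mono sum_mono dle) auto
  also have "\<dots> = 16 * 2 ^ n * ((r ^ m)\<^sup>2 * (\<Sum>j<k. \<Sum>S\<in>Pow {..<n}. (F j S)\<^sup>2))"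
    by (simp add: sum_distrib_left)
  also have "\<dots> \<le> 16 * 2 ^ n * ((r ^ m)\<^sup>2 * 1)"
    using ball_fourier_total[OF f] unfolding F_def by (intro mult_left_mono) auto
  finally show ?thesis unfolding c_def by (simp add: field_simps)
qed

section \<open>Random signs as a product measure\<close>

text \<open>Pushed forward to a Borel measure on the reals, so that signs and Gaussians both
  instantiate \<open>standardised_family\<close>.\<close>

definition rademacher :: "real measure" where
  "rademacher = distr (measure_pmf (pmf_of_set {-1, 1})) borel (\<lambda>x. x)"

lemma integral_rademacher:
  fixes g :: "real \<Rightarrow> real"
  assumes [measurable]: "g \<in> borel_measurable borel"
  shows "(\<integral>t. g t \<partial>rademacher) = (g (-1) + g 1) / 2"
  unfolding rademacher_def by (subst integral_distr) (auto simp: integral_pmf_of_set)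

lemma nn_integral_rademacher:
  assumes [measurable]: "g \<in> borel_measurable borel"
  shows "(\<integral>\<^sup>+t. g t \<partial>rademacher) = (g (-1) + g 1) / 2"
  unfolding rademacher_def by (subst nn_integral_distr) (auto simp: nn_integral_pmf_of_set)

lemma standardised_rademacher: "standardised rademacher"
proof -
  have "prob_space rademacher" unfolding rademacher_def
    by (rule prob_space.prob_space_distr) (auto intro: measure_pmf.prob_space_axioms)
  moreover have "integrable rademacher (\<lambda>t. t ^ 4)" unfolding rademacher_def
    by (subst integrable_distr_eq) (auto intro!: integrable_measure_pmf_finite)
  ultimately show ?thesis
    by (simp add: standardised_def integral_rademacher) (simp add: rademacher_def)
qed

text \<open>The induction peels off the last coordinate and is done for nonnegative extended
  integrals, where Tonelli asks only for measurability.\<close>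

lemma nn_integral_PiM_rademacher:
  assumes "F \<in> borel_measurable (PiM {..<n} (\<lambda>_. rademacher))"
  shows "(\<integral>\<^sup>+x. F x \<partial>PiM {..<n} (\<lambda>_. rademacher)) = (\<Sum>x\<in>cube n. F x) / 2 ^ n"
  using assms
proof (induction n arbitrary: F)
  case 0
  interpret standardised_family "\<lambda>_::nat. rademacher" by unfold_locales (rule standardised_rademacher)
  show ?case by (simp add: cube_def nn_integral_empty divide_ennreal_def)
next
  case (Suc n)
  interpret standardised_family "\<lambda>_::nat. rademacher" by unfold_locales (rule standardised_rademacher)
  note [measurable] = Suc.prems
  have ins: "insert n {..<n} = {..<Suc n}" by auto
  have m: "(\<lambda>x. F (x(n := t))) \<in> borel_measurable (PiM {..<n} (\<lambda>_. rademacher))" for t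
  proof -
    have "(\<lambda>x. x(n := t)) \<in> measurable (PiM {..<n} (\<lambda>_. rademacher)) (PiM (insert n {..<n}) (\<lambda>_. rademacher))"
      by (rule measurable_fun_upd[where J="{..<n}"]) (auto simp: rademacher_def)
    then show ?thesis unfolding ins by (rule measurable_compose) (rule Suc.prems)
  qed
  have "(\<integral>\<^sup>+x. F x \<partial>PiM {..<Suc n} (\<lambda>_. rademacher))
      = (\<integral>\<^sup>+x. (\<integral>\<^sup>+t. F (x(n := t)) \<partial>rademacher) \<partial>PiM {..<n} (\<lambda>_. rademacher))"
    using product_nn_integral_insert[of "{..<n}" n F] Suc.prems unfolding ins by simp
  also have "\<dots> = (\<integral>\<^sup>+x. (F (x(n := -1)) + F (x(n := 1))) / 2 \<partial>PiM {..<n} (\<lambda>_. rademacher))"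
  proof (rule nn_integral_cong)
    fix x assume x: "x \<in> space (PiM {..<n} (\<lambda>_. rademacher))"
    have "(\<lambda>t. x(n := t)) \<in> measurable rademacher (PiM (insert n {..<n}) (\<lambda>_. rademacher))"
      using x by (intro measurable_component_update) auto
    then have "(\<lambda>t. F (x(n := t))) \<in> borel_measurable rademacher"
      unfolding ins by (rule measurable_compose) (rule Suc.prems)
    then have "(\<lambda>t. F (x(n := t))) \<in> borel_measurable borel"
      by (simp add: measurable_cong_sets[OF sets_M refl])
    then show "(\<integral>\<^sup>+t. F (x(n := t)) \<partial>rademacher) = (F (x(n := -1)) + F (x(n := 1))) / 2"
      by (rule nn_integral_rademacher)
  qed
  also have "\<dots> = ((\<Sum>x\<in>cube n. F (x(n := -1))) / 2 ^ n + (\<Sum>x\<in>cube n. F (x(n := 1))) / 2 ^ n) / 2"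
    using m by (simp add: nn_integral_divide nn_integral_add Suc.IH)
  also have "\<dots> = ((\<Sum>x\<in>cube n. F (x(n := -1))) + (\<Sum>x\<in>cube n. F (x(n := 1)))) / 2 ^ Suc n"
  proof -
    have "inverse (2 * 2 ^ n :: ennreal) = inverse 2 * inverse (2 ^ n)"
      by (rule ennreal_inverse_mult) (auto simp: power_less_top_ennreal)
    then show ?thesis by (simp add: divide_ennreal_def distrib_left distrib_right ac_simps)
  qed
  also have "(\<Sum>x\<in>cube n. F (x(n := -1))) + (\<Sum>x\<in>cube n. F (x(n := 1))) = (\<Sum>x\<in>cube (Suc n). F x)"
  proof -
    \<comment> \<open>Points of \<open>cube n\<close> are extensional, with value
      \<open>undefined\<close> at \<open>n\<close>, so the update at \<open>n\<close> loses
      nothing.\<close>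
    have inj: "inj_on (\<lambda>x. x(n := t)) (cube n)" for t
    proof (rule inj_onI)
      fix x y assume xy: "x \<in> cube n" "y \<in> cube n" "x(n := t) = y(n := t)"
      have "x n = undefined" "y n = undefined" using xy by (auto simp: cube_def PiE_def extensional_def)
      then show "x = y" using xy(3) by (metis fun_upd_idem_iff fun_upd_upd)
    qed
    have "cube (Suc n) = (\<lambda>x. x(n := -1)) ` cube n \<union> (\<lambda>x. x(n := 1)) ` cube n"
      unfolding cube_def lessThan_Suc PiE_insert_eq by (auto simp: image_iff) 
    moreover have "(\<lambda>x. x(n := -1)) ` cube n \<inter> (\<lambda>x. x(n := 1)) ` cube n = {}"
      by (auto dest!: fun_cong[of _ _ n])
    ultimately show ?thesis
      using inj by (simp add: sum.union_disjoint sum.reindex)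
  qed
  finally show ?case .
qed

lemma integral_PiM_rademacher:
  fixes F :: "(nat \<Rightarrow> real) \<Rightarrow> real"
  assumes "F \<in> borel_measurable (PiM {..<n} (\<lambda>_. rademacher))" "\<And>x. 0 \<le> F x"
  shows "(\<integral>x. F x \<partial>PiM {..<n} (\<lambda>_. rademacher)) = (\<Sum>x\<in>cube n. F x) / 2 ^ n"
proof -
  have "(\<integral>\<^sup>+x. ennreal (F x) \<partial>PiM {..<n} (\<lambda>_. rademacher)) = (\<Sum>x\<in>cube n. ennreal (F x)) / 2 ^ n"
    using assms by (intro nn_integral_PiM_rademacher) auto
  also have "\<dots> = ennreal ((\<Sum>x\<in>cube n. F x) / 2 ^ n)"
    using assms by (simp add: divide_ennreal[symmetric] sum_nonneg ennreal_power[symmetric])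
  finally show ?thesis
    using assms by (subst integral_eq_nn_integral) (auto simp: sum_nonneg)
qed

section \<open>Gaussian noise stability\<close>

text \<open>Polarisation of \<open>mlpoly_second_moment\<close>.\<close>

lemma (in standardised_family) mlpoly_inner:
  assumes "finite I"
  shows "integrable (PiM I M) (\<lambda>x. mlpoly I c x * mlpoly I d x)"
    and "(\<integral>x. mlpoly I c x * mlpoly I d x \<partial>PiM I M) = (\<Sum>S\<in>Pow I. c S * d S)"
proof -
  have e: "mlpoly I c x * mlpoly I d x = ((mlpoly I (\<lambda>S. c S + d S) x)\<^sup>2 - (mlpoly I (\<lambda>S. c S - d S) x)\<^sup>2) / 4" for x
  proof -
    have "mlpoly I (\<lambda>S. c S + d S) x = mlpoly I c x + mlpoly I d x" "mlpoly I (\<lambda>S. c S - d S) x = mlpoly I c x - mlpoly I d x"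
      by (simp_all add: mlpoly_def distrib_right left_diff_distrib sum.distrib sum_subtractf)
    then show ?thesis by (simp only:) (simp add: power2_eq_square algebra_simps)
  qed
  show "integrable (PiM I M) (\<lambda>x. mlpoly I c x * mlpoly I d x)"
    unfolding e using assms by (simp add: mlpoly_second_moment)
  have "(\<integral>x. mlpoly I c x * mlpoly I d x \<partial>PiM I M) = ((\<Sum>S\<in>Pow I. (c S + d S)\<^sup>2) - (\<Sum>S\<in>Pow I. (c S - d S)\<^sup>2)) / 4"
    unfolding e using assms by (simp add: mlpoly_second_moment)
  also have "\<dots> = (\<Sum>S\<in>Pow I. ((c S + d S)\<^sup>2 - (c S - d S)\<^sup>2) / 4)"
    unfolding sum_subtractf[symmetric] sum_divide_distrib ..
  also have "\<dots> = (\<Sum>S\<in>Pow I. c S * d S)"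
    by (intro sum.cong refl) (simp add: power2_eq_square algebra_simps)
  finally show "(\<integral>x. mlpoly I c x * mlpoly I d x \<partial>PiM I M) = (\<Sum>S\<in>Pow I. c S * d S)" .
qed

lemma standardised_std_normal: "standardised std_normal_distribution"
proof -
  have "(\<integral>x. x ^ 4 \<partial>std_normal_distribution) = 3"
    using std_normal_distribution_even_moments(1)[of 2] by (simp add: eval_nat_numeral)
  moreover have "(\<integral>x. x\<^sup>2 \<partial>std_normal_distribution) = 1"
    using std_normal_distribution_even_moments(1)[of 1] by simp
  moreover have "(\<integral>x. x \<partial>std_normal_distribution) = 0"
    using integral_std_normal_distribution_moment_odd[of 1] by simp
  moreover have "(\<integral>x. x ^ 3 \<partial>std_normal_distribution) = 0"
    using integral_std_normal_distribution_moment_odd[of 3] by simp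
  moreover have "prob_space std_normal_distribution"
    using real_dist_normal_dist by (simp add: real_distribution_def)
  ultimately show ?thesis
    using integrable_std_normal_distribution_moment[of 4] by (simp add: standardised_def)
qed

interpretation gauss: standardised_family "\<lambda>_. std_normal_distribution"
  by unfold_locales (rule standardised_std_normal)

interpretation gauss_prob: prob_space "gauss_space n"
  unfolding gauss_space_def by (rule gauss.prob_PiM)

lemma sets_gauss_space [measurable_cong]: "sets (gauss_space n) = sets (PiM {..<n} (\<lambda>_. borel))"
  unfolding gauss_space_def by (intro sets_PiM_cong) auto

text \<open>By uniqueness of characteristic functions: independence factors them, and the variances
  \<open>\<rho>\<^sup>2\<close> and \<open>1 - \<rho>\<^sup>2\<close> add up to 1.\<close>

lemma normal_combination:
  assumes "\<bar>\<rho>\<bar> \<le> 1"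
  shows "distr (std_normal_distribution \<Otimes>\<^sub>M std_normal_distribution) borel
      (\<lambda>(x, z). \<rho> * x + sqrt (1 - \<rho>\<^sup>2) * z) = std_normal_distribution"
    (is "distr ?P borel ?h = ?N")
proof -
  interpret N: prob_space ?N by (rule gauss.prob_M)
  interpret P: pair_prob_space ?N ?N ..
  define s where "s = sqrt (1 - \<rho>\<^sup>2)"
  have s2: "s\<^sup>2 = 1 - \<rho>\<^sup>2" using assms by (simp add: s_def abs_square_le_1)
  have m[measurable]: "?h \<in> borel_measurable ?P" by measurable
  show ?thesis
  proof (rule Levy_uniqueness)
    show "real_distribution (distr ?P borel ?h)" by (rule P.real_distribution_distr[OF m])
    show "real_distribution ?N" by (rule real_dist_normal_dist)
    show "char (distr ?P borel ?h) = char ?N"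
    proof
      fix t
      have e: "iexp (t * ?h w) = iexp ((t * \<rho>) * fst w) * iexp ((t * s) * snd w)" for w
        by (simp add: exp_add[symmetric] s_def algebra_simps split: prod.split)
      have "char (distr ?P borel ?h) t = (\<integral>w. iexp (t * ?h w) \<partial>?P)"
        unfolding char_def by (subst integral_distr) auto
      also have "\<dots> = (\<integral>w. iexp ((t * \<rho>) * fst w) * iexp ((t * s) * snd w) \<partial>?P)" unfolding e ..
      also have "\<dots> = (\<integral>x. (\<integral>z. iexp ((t * \<rho>) * x) * iexp ((t * s) * z) \<partial>?N) \<partial>?N)"
      proof -
        have "integrable ?P (\<lambda>w. iexp ((t * \<rho>) * fst w) * iexp ((t * s) * snd w))"
          by (rule P.integrable_const_bound[where B=1]) (auto simp: norm_mult)
        from P.integral_fst'[OF this] show ?thesis by simp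
      qed
      also have "\<dots> = char ?N (t * \<rho>) * char ?N (t * s)" unfolding char_def by simp
      also have "\<dots> = exp (- ((t * \<rho>)\<^sup>2) / 2) * exp (- ((t * s)\<^sup>2) / 2)"
        by (simp add: char_std_normal_distribution)
      also have "\<dots> = exp (- (t\<^sup>2) / 2)"
      proof -
        have "- ((t * \<rho>)\<^sup>2) / 2 + - ((t * s)\<^sup>2) / 2 = - (t\<^sup>2) / 2"
          by (simp add: power_mult_distrib s2 field_simps)
        then show ?thesis by (simp only: exp_add[symmetric] of_real_mult[symmetric])
      qed
      finally show "char (distr ?P borel ?h) t = char ?N t" by (simp add: char_std_normal_distribution)
    qed
  qed
qed

lemma measurable_corr [measurable]:
  "(\<lambda>(x, z). corr n \<rho> x z) \<in> measurable (gauss_space n \<Otimes>\<^sub>M gauss_space n) (gauss_space n)"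
proof -
  have "(\<lambda>w. \<lambda>i\<in>{..<n}. \<rho> * fst w i + sqrt (1 - \<rho>\<^sup>2) * snd w i)
     \<in> measurable (gauss_space n \<Otimes>\<^sub>M gauss_space n) (PiM {..<n} (\<lambda>_. borel))"
    by measurable
  then show ?thesis
    by (simp add: corr_def split_beta' measurable_cong_sets[OF refl sets_gauss_space])
qed

text \<open>A product measure is determined by its values on boxes; there \<open>corr\<close> acts
  coordinatewise and everything factors into \<open>normal_combination\<close>. That both correlated
  points have the same law is what the clipping estimate uses.\<close>

lemma distr_corr:
  assumes "\<bar>\<rho>\<bar> \<le> 1"
  shows "distr (gauss_space n \<Otimes>\<^sub>M gauss_space n) (gauss_space n) (\<lambda>(x, z). corr n \<rho> x z) = gauss_space n"
    (is "distr ?P _ ?h = _")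
proof -
  let ?N = "std_normal_distribution"
  interpret N: prob_space ?N by (rule gauss.prob_M)
  define s where "s = sqrt (1 - \<rho>\<^sup>2)"
  have "distr ?P (gauss_space n) ?h = PiM {..<n} (\<lambda>_. ?N)"
  proof (rule gauss.PiM_eqI)
    fix A assume "\<And>i. i \<in> {..<n} \<Longrightarrow> A i \<in> sets ?N"
    then have A: "A i \<in> sets borel" if "i < n" for i using that by auto
    have PA: "PiE {..<n} A \<in> sets (gauss_space n)"
      unfolding sets_gauss_space using A by (intro sets_PiM_I_finite) auto
    have one: "(\<integral>\<^sup>+x. (\<integral>\<^sup>+z. indicator (A i) (\<rho> * x + s * z) \<partial>?N) \<partial>?N) = emeasure ?N (A i)" if "i < n" for i
    proof -
      note [measurable] = A[OF that]
      have "emeasure ?N (A i) = (\<integral>\<^sup>+y. indicator (A i) y \<partial>distr (?N \<Otimes>\<^sub>M ?N) borel (\<lambda>(x, z). \<rho> * x + s * z))"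
        unfolding s_def normal_combination[OF assms] by simp
      also have "\<dots> = (\<integral>\<^sup>+w. indicator (A i) (\<rho> * fst w + s * snd w) \<partial>(?N \<Otimes>\<^sub>M ?N))"
        by (subst nn_integral_distr) (auto simp: split_beta')
      also have "\<dots> = (\<integral>\<^sup>+x. (\<integral>\<^sup>+z. indicator (A i) (\<rho> * x + s * z) \<partial>?N) \<partial>?N)"
        by (subst sigma_finite_measure.nn_integral_fst[OF prob_space_imp_sigma_finite[OF gauss.prob_M], symmetric]) auto
      finally show ?thesis by simp
    qed
    have ind: "indicator (PiE {..<n} A) (corr n \<rho> x z) = (\<Prod>i<n. indicator (A i) (\<rho> * x i + s * z i) :: ennreal)" for x z
    proof (cases "\<forall>i<n. \<rho> * x i + s * z i \<in> A i")
      case True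
      then show ?thesis by (auto simp: corr_def s_def indicator_def PiE_def Pi_def)
    next
      case False
      then obtain i where "i < n" "\<rho> * x i + s * z i \<notin> A i" by auto
      then have "(\<Prod>i<n. indicator (A i) (\<rho> * x i + s * z i) :: ennreal) = 0" by (intro prod_zero bexI[of _ i]) auto
      moreover have "corr n \<rho> x z \<notin> PiE {..<n} A"
        using \<open>i < n\<close> \<open>\<rho> * x i + s * z i \<notin> A i\<close> by (auto simp: corr_def s_def PiE_def Pi_def)
      ultimately show ?thesis by simp
    qed
    have "emeasure (distr ?P (gauss_space n) ?h) (PiE {..<n} A)
        = (\<integral>\<^sup>+w. indicator (PiE {..<n} A) (?h w) \<partial>?P)"
    proof -
      have "emeasure (distr ?P (gauss_space n) ?h) (PiE {..<n} A)
          = (\<integral>\<^sup>+y. indicator (PiE {..<n} A) y \<partial>distr ?P (gauss_space n) ?h)"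
        using PA by simp
      also have "\<dots> = (\<integral>\<^sup>+w. indicator (PiE {..<n} A) (?h w) \<partial>?P)"
        using PA by (intro nn_integral_distr measurable_corr) auto
      finally show ?thesis .
    qed
    also have "\<dots> = (\<integral>\<^sup>+x. (\<integral>\<^sup>+z. indicator (PiE {..<n} A) (corr n \<rho> x z) \<partial>gauss_space n) \<partial>gauss_space n)"
      using PA by (subst gauss_prob.nn_integral_fst[symmetric]) (auto intro!: measurable_compose[OF measurable_corr])
    also have "\<dots> = (\<integral>\<^sup>+x. (\<Prod>i<n. \<integral>\<^sup>+z. indicator (A i) (\<rho> * x i + s * z) \<partial>?N) \<partial>gauss_space n)"
      unfolding ind gauss_space_def using A by (subst gauss.product_nn_integral_prod) auto
    also have "\<dots> = (\<Prod>i<n. \<integral>\<^sup>+x. (\<integral>\<^sup>+z. indicator (A i) (\<rho> * x + s * z) \<partial>?N) \<partial>?N)"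
      unfolding gauss_space_def using A
      by (subst gauss.product_nn_integral_prod[where f="\<lambda>i x. \<integral>\<^sup>+z. indicator (A i) (\<rho> * x + s * z) \<partial>?N"]) auto
    also have "\<dots> = (\<Prod>i<n. emeasure ?N (A i))" using one by (intro prod.cong) auto
    finally show "emeasure (distr ?P (gauss_space n) ?h) (PiE {..<n} A) = (\<Prod>i<n. emeasure ?N (A i))" .
  qed (auto simp: gauss_space_def)
  then show ?thesis by (simp add: gauss_space_def)
qed

lemma gauss_restrict:
  assumes "k \<le> n"
  shows "distr (gauss_space n) (gauss_space k) (\<lambda>x. restrict x {..<k}) = gauss_space k"
proof -
  interpret product_prob_space "\<lambda>_::nat. std_normal_distribution" UNIV
    by (rule product_prob_spaceI) (rule gauss.prob_M)
  show ?thesis unfolding gauss_space_def using assms by (intro distr_restrict[symmetric]) auto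
qed

lemma measurable_gauss_restrict:
  assumes "k \<le> n"
  shows "(\<lambda>x. restrict x {..<k}) \<in> measurable (gauss_space n) (gauss_space k)"
  unfolding gauss_space_def using assms by (intro measurable_restrict_subset) auto

text \<open>Serves twice: for the stability of \<open>f_opt\<close> in higher dimension, and for
  discarding dummy coordinates.\<close>

lemma integral_gauss_restrict:
  fixes h :: "(nat \<Rightarrow> real) \<Rightarrow> real"
  assumes "k \<le> n" "h \<in> borel_measurable (gauss_space k)"
  shows "(\<integral>x. h (restrict x {..<k}) \<partial>gauss_space n) = (\<integral>x. h x \<partial>gauss_space k)"
  using integral_distr[OF measurable_gauss_restrict[OF assms(1)] assms(2)] gauss_restrict[OF assms(1)] by simp

lemma measurable_f_opt [measurable]:
  assumes "k \<le> n" shows "(\<lambda>x. f_opt k x j) \<in> borel_measurable (gauss_space n)"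
proof (cases "j < k")
  case True
  have [measurable]: "(\<lambda>x. x i) \<in> borel_measurable (gauss_space n)" if "i < n" for i
    using measurable_component_singleton[of i "{..<n}" "\<lambda>_. borel"] that
    by (simp add: measurable_cong_sets[OF sets_gauss_space refl])
  have "(\<lambda>x. x j / sqrt (\<Sum>i<k. (x i)\<^sup>2)) \<in> borel_measurable (gauss_space n)"
    using assms True by (intro borel_measurable_divide borel_measurable_sqrt borel_measurable_sum borel_measurable_power) auto
  then show ?thesis using True by (simp add: f_opt_def)
qed (simp add: f_opt_def)

text \<open>\<open>Fstar\<close> lives in dimension \<open>k\<close>, whereas the hypothesis is used
  in a larger one. As \<open>f_opt k\<close> reads only the first \<open>k\<close> coordinates and
  \<open>corr\<close> acts coordinatewise, the others integrate out.\<close>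

lemma gauss_stab_f_opt:
  assumes "k \<le> n"
  shows "gauss_stab n k \<rho> (f_opt k) = Fstar k \<rho>"
proof -
  define H where "H = (\<lambda>x z. inner_k k (f_opt k x) (f_opt k (corr k \<rho> x z)))"
  have fr: "f_opt k (restrict x {..<k}) = f_opt k x" for x by (simp add: f_opt_def fun_eq_iff)
  have fc: "f_opt k (corr n \<rho> x z) = f_opt k (corr k \<rho> (restrict x {..<k}) (restrict z {..<k}))" for x z
    using assms by (auto simp: f_opt_def fun_eq_iff corr_def intro!: sum.cong arg_cong2[of _ _ _ _ "(/)"] arg_cong[of _ _ sqrt])
  have e: "inner_k k (f_opt k x) (f_opt k (corr n \<rho> x z)) = H (restrict x {..<k}) (restrict z {..<k})" for x z
    unfolding H_def fr fc ..
  have fm[measurable]: "(\<lambda>x. f_opt k x j) \<in> borel_measurable (gauss_space k)" for j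
    by (rule measurable_f_opt) simp
  have [measurable]: "(\<lambda>w. f_opt k (corr k \<rho> (fst w) (snd w)) j) \<in> borel_measurable (gauss_space k \<Otimes>\<^sub>M gauss_space k)" for j
    using measurable_compose[OF measurable_corr fm[of j]] by (simp add: split_beta')
  have mH: "(\<lambda>w. H (fst w) (snd w)) \<in> borel_measurable (gauss_space k \<Otimes>\<^sub>M gauss_space k)"
    unfolding H_def inner_k_def by measurable
  have mH2: "H x \<in> borel_measurable (gauss_space k)" if "x \<in> space (gauss_space k)" for x
    using measurable_compose[OF measurable_Pair1'[OF that] mH] by simp
  have mH1: "(\<lambda>x. \<integral>z. H x z \<partial>gauss_space k) \<in> borel_measurable (gauss_space k)"
    using mH by (intro gauss_prob.borel_measurable_lebesgue_integral) (simp add: split_beta')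
  have "gauss_stab n k \<rho> (f_opt k) = (\<integral>x. (\<integral>z. H (restrict x {..<k}) (restrict z {..<k}) \<partial>gauss_space n) \<partial>gauss_space n)"
    unfolding gauss_stab_def e ..
  also have "\<dots> = (\<integral>x. (\<integral>z. H (restrict x {..<k}) z \<partial>gauss_space k) \<partial>gauss_space n)"
  proof (rule Bochner_Integration.integral_cong[OF refl])
    fix x assume "x \<in> space (gauss_space n)"
    then have "restrict x {..<k} \<in> space (gauss_space k)"
      using measurable_space[OF measurable_gauss_restrict[OF assms]] by simp
    then show "(\<integral>z. H (restrict x {..<k}) (restrict z {..<k}) \<partial>gauss_space n) = (\<integral>z. H (restrict x {..<k}) z \<partial>gauss_space k)"
      by (intro integral_gauss_restrict assms mH2)
  qed
  also have "\<dots> = (\<integral>x. (\<integral>z. H x z \<partial>gauss_space k) \<partial>gauss_space k)"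
    by (rule integral_gauss_restrict[OF assms mH1])
  finally show ?thesis by (simp add: Fstar_def gauss_stab_def H_def)
qed

text \<open>The Ornstein-Uhlenbeck operator: each coordinate \<open>\<rho> * x i + s * z i\<close>
  averages to \<open>\<rho> * x i\<close>, so a multilinear monomial picks up
  \<open>\<rho> ^ card S\<close>, the same multiplier as on the cube.\<close>

lemma gauss_mlpoly_corr:
  "(\<integral>z. mlpoly {..<n} c (corr n \<rho> x z) \<partial>gauss_space n) = mlpoly {..<n} (\<lambda>S. \<rho> ^ card S * c S) x"
  "integrable (gauss_space n) (\<lambda>z. mlpoly {..<n} c (corr n \<rho> x z))"
proof -
  let ?N = "std_normal_distribution"
  interpret N: prob_space ?N by (rule gauss.prob_M)
  define s where "s = sqrt (1 - \<rho>\<^sup>2)"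
  define \<phi> where "\<phi> = (\<lambda>S i t. if i \<in> S then \<rho> * x i + s * t else 1)"
  have i1: "integrable ?N (\<lambda>t. t)" using standardised_integrable_power[OF standardised_std_normal, of 1] by simp
  have m1: "(\<integral>t. t \<partial>?N) = 0" using standardised_std_normal by (simp add: standardised_def)
  have i\<phi>: "integrable ?N (\<phi> S i)" and v\<phi>: "(\<integral>t. \<phi> S i t \<partial>?N) = (if i \<in> S then \<rho> * x i else 1)" for S i
    using i1 m1 N.prob_space by (cases "i \<in> S"; simp add: \<phi>_def)+
  have chi: "chi S (corr n \<rho> x z) = (\<Prod>i<n. \<phi> S i (z i))" if "S \<subseteq> {..<n}" for S z
  proof -
    have "chi S (corr n \<rho> x z) = (\<Prod>i\<in>S. \<rho> * x i + s * z i)"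
      unfolding chi_def using that by (intro prod.cong) (auto simp: corr_def s_def)
    also have "\<dots> = (\<Prod>i<n. \<phi> S i (z i))"
      unfolding \<phi>_def using that by (simp add: prod.If_cases Int_absorb1)
    finally show ?thesis .
  qed
  have ic: "integrable (gauss_space n) (\<lambda>z. chi S (corr n \<rho> x z))"
    and vc: "(\<integral>z. chi S (corr n \<rho> x z) \<partial>gauss_space n) = \<rho> ^ card S * chi S x" if S: "S \<subseteq> {..<n}" for S
  proof -
    show "integrable (gauss_space n) (\<lambda>z. chi S (corr n \<rho> x z))"
      unfolding chi[OF S] gauss_space_def by (intro gauss.product_integrable_prod i\<phi>) auto
    have "(\<integral>z. chi S (corr n \<rho> x z) \<partial>gauss_space n) = (\<Prod>i<n. if i \<in> S then \<rho> * x i else 1)"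
      unfolding chi[OF S] gauss_space_def by (subst gauss.product_integral_prod) (auto simp: i\<phi> v\<phi>)
    also have "\<dots> = \<rho> ^ card S * chi S x"
      unfolding chi_def using S by (simp add: prod.If_cases Int_absorb1 prod.distrib)
    finally show "(\<integral>z. chi S (corr n \<rho> x z) \<partial>gauss_space n) = \<rho> ^ card S * chi S x" .
  qed
  show "integrable (gauss_space n) (\<lambda>z. mlpoly {..<n} c (corr n \<rho> x z))"
    unfolding mlpoly_def using ic by auto
  have "(\<integral>z. mlpoly {..<n} c (corr n \<rho> x z) \<partial>gauss_space n)
      = (\<Sum>S\<in>Pow {..<n}. \<integral>z. c S * chi S (corr n \<rho> x z) \<partial>gauss_space n)"
    unfolding mlpoly_def using ic by (intro Bochner_Integration.integral_sum) auto
  then show "(\<integral>z. mlpoly {..<n} c (corr n \<rho> x z) \<partial>gauss_space n) = mlpoly {..<n} (\<lambda>S. \<rho> ^ card S * c S) x"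
    by (simp add: vc mlpoly_def ac_simps)
qed

lemma gauss_stab_mlpoly:
  "gauss_stab n k \<rho> (\<lambda>x j. mlpoly {..<n} (c j) x) = (\<Sum>j<k. \<Sum>S\<in>Pow {..<n}. \<rho> ^ card S * (c j S)\<^sup>2)"
proof -
  have "gauss_stab n k \<rho> (\<lambda>x j. mlpoly {..<n} (c j) x)
      = (\<integral>x. (\<Sum>j<k. mlpoly {..<n} (c j) x * mlpoly {..<n} (\<lambda>S. \<rho> ^ card S * c j S) x) \<partial>gauss_space n)"
    unfolding gauss_stab_def inner_k_def
    by (intro Bochner_Integration.integral_cong refl) (simp add: gauss_mlpoly_corr)
  also have "\<dots> = (\<Sum>j<k. \<Sum>S\<in>Pow {..<n}. c j S * (\<rho> ^ card S * c j S))"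
    unfolding gauss_space_def by (simp add: gauss.mlpoly_inner)
  finally show ?thesis by (simp add: power2_eq_square ac_simps)
qed

section \<open>Clipping to the ball and the main theorem\<close>

text \<open>Young's inequality with a free \<open>\<theta>\<close>: a small displacement is divided
  by \<open>\<theta>\<close>, a merely bounded factor is multiplied by it.\<close>

lemma sum_mult_le_weighted:
  fixes \<theta> :: real and k :: nat and a b :: "nat \<Rightarrow> real"
  assumes "0 < \<theta>"
  shows "(\<Sum>j<k. a j * b j) \<le> ((\<Sum>j<k. (a j)\<^sup>2) / \<theta> + \<theta> * (\<Sum>j<k. (b j)\<^sup>2)) / 2"
proof -
  have "a j * b j \<le> ((a j)\<^sup>2 / \<theta> + \<theta> * (b j)\<^sup>2) / 2" for j
  proof -
    have "0 \<le> (a j - \<theta> * b j)\<^sup>2 / \<theta>" using assms by simp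
    also have "\<dots> = (a j)\<^sup>2 / \<theta> + \<theta> * (b j)\<^sup>2 - 2 * (a j * b j)"
      using assms by (simp add: field_simps power2_eq_square)
    finally show ?thesis by simp
  qed
  then have "(\<Sum>j<k. a j * b j) \<le> (\<Sum>j<k. ((a j)\<^sup>2 / \<theta> + \<theta> * (b j)\<^sup>2) / 2)" by (intro sum_mono)
  also have "\<dots> = ((\<Sum>j<k. (a j)\<^sup>2) / \<theta> + \<theta> * (\<Sum>j<k. (b j)\<^sup>2)) / 2"
    by (simp add: sum.distrib sum_divide_distrib sum_distrib_left add_divide_distrib)
  finally show ?thesis .
qed

text \<open>Radial projection of the first \<open>k\<close> coordinates onto the unit ball;
  \<open>max 1\<close> leaves the ball fixed and avoids division by 0.\<close>

definition clip :: "nat \<Rightarrow> (nat \<Rightarrow> real) \<Rightarrow> nat \<Rightarrow> real" where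
  "clip k u = (\<lambda>j. u j / max 1 (sqrt (\<Sum>i<k. (u i)\<^sup>2)))"

lemma clip_in_ball: "(\<Sum>j<k. (clip k u j)\<^sup>2) \<le> 1"
proof -
  define R where "R = sqrt (\<Sum>i<k. (u i)\<^sup>2)"
  have R: "0 \<le> R" "R\<^sup>2 = (\<Sum>i<k. (u i)\<^sup>2)" by (auto simp: R_def sum_nonneg)
  have "(\<Sum>j<k. (clip k u j)\<^sup>2) = R\<^sup>2 / (max 1 R)\<^sup>2"
    unfolding R(2) by (simp add: clip_def R_def[symmetric] power_divide sum_divide_distrib)
  also have "\<dots> \<le> 1" using R(1) by (simp add: divide_le_eq power_mono)
  finally show ?thesis .
qed

lemma clip_dist: "(\<Sum>j<k. (u j - clip k u j)\<^sup>2) = (max 0 (sqrt (\<Sum>i<k. (u i)\<^sup>2) - 1))\<^sup>2"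
proof -
  define R where "R = sqrt (\<Sum>i<k. (u i)\<^sup>2)"
  have R: "0 \<le> R" "R\<^sup>2 = (\<Sum>i<k. (u i)\<^sup>2)" by (auto simp: R_def sum_nonneg)
  have "u j - clip k u j = (1 - 1 / max 1 R) * u j" for j
    by (simp add: clip_def R_def left_diff_distrib)
  then have "(\<Sum>j<k. (u j - clip k u j)\<^sup>2) = (1 - 1 / max 1 R)\<^sup>2 * R\<^sup>2"
    unfolding R(2) by (simp add: power_mult_distrib sum_distrib_left)
  also have "\<dots> = (max 0 (R - 1))\<^sup>2"
  proof (cases "R \<le> 1")
    case False
    then have "(1 - 1 / max 1 R) * R = max 0 (R - 1)" by (simp add: field_simps max_def)
    then show ?thesis by (simp flip: power_mult_distrib)
  qed simp
  finally show ?thesis by (simp add: R_def)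
qed

text \<open>One argument is changed at a time: the displacement of \<open>u\<close> is paired with
  \<open>v\<close>, that of \<open>v\<close> with \<open>clip k u\<close>. The latter lies in the
  ball; the squared norm of \<open>v\<close> is kept, because it will be bounded only in
  mean.\<close>

lemma inner_clip_le:
  assumes "0 < \<theta>"
  shows "inner_k k (clip k u) (clip k v) \<le> inner_k k u v
    + ((\<Sum>j<k. (u j - clip k u j)\<^sup>2) / \<theta> + \<theta> * (\<Sum>j<k. (v j)\<^sup>2)
      + (\<Sum>j<k. (v j - clip k v j)\<^sup>2) / \<theta> + \<theta>) / 2"
proof -
  have "inner_k k (clip k u) (clip k v) - inner_k k u v
      = (\<Sum>j<k. (clip k u j - u j) * v j) + (\<Sum>j<k. (clip k v j - v j) * clip k u j)"
    unfolding inner_k_def by (simp add: sum_subtractf[symmetric] sum.distrib[symmetric] algebra_simps)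
  also have "\<dots> \<le> ((\<Sum>j<k. (clip k u j - u j)\<^sup>2) / \<theta> + \<theta> * (\<Sum>j<k. (v j)\<^sup>2)) / 2
      + ((\<Sum>j<k. (clip k v j - v j)\<^sup>2) / \<theta> + \<theta> * (\<Sum>j<k. (clip k u j)\<^sup>2)) / 2"
    by (intro add_mono sum_mult_le_weighted assms)
  also have "\<dots> \<le> ((\<Sum>j<k. (clip k u j - u j)\<^sup>2) / \<theta> + \<theta> * (\<Sum>j<k. (v j)\<^sup>2)) / 2
      + ((\<Sum>j<k. (clip k v j - v j)\<^sup>2) / \<theta> + \<theta> * 1) / 2"
    using assms by (intro add_left_mono divide_right_mono mult_left_mono clip_in_ball) auto
  finally show ?thesis by (simp add: power2_commute add_divide_distrib)
qed

text \<open>\<open>inner_clip_le\<close> is integrated over a correlated pair. Both points have the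
  Gaussian law, so the two displacement terms have equal integrals and together give the integral of
  \<open>D\<close> over \<open>\<theta>\<close>; the other two halves add up to at most
  \<open>\<theta>\<close> because \<open>total\<close> bounds the second moment by 1.\<close>

lemma gauss_stab_clip:
  fixes c :: "nat \<Rightarrow> nat set \<Rightarrow> real"
  assumes \<rho>: "\<bar>\<rho>\<bar> \<le> 1" and \<theta>: "0 < \<theta>"
    and total: "(\<Sum>j<k. \<Sum>S\<in>Pow {..<n}. (c j S)\<^sup>2) \<le> 1"
  defines "p \<equiv> \<lambda>x j. mlpoly {..<n} (c j) x"
  defines "D \<equiv> \<lambda>x. (max 0 (sqrt (\<Sum>j<k. (p x j)\<^sup>2) - 1))\<^sup>2"
  shows "gauss_ball_fun n k (\<lambda>x. clip k (p x))"
    and "integrable (gauss_space n) D"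
    and "gauss_stab n k \<rho> (\<lambda>x. clip k (p x)) \<le> gauss_stab n k \<rho> p + \<theta> + (\<integral>x. D x \<partial>gauss_space n) / \<theta>"
proof -
  let ?G = "gauss_space n"
  let ?P = "?G \<Otimes>\<^sub>M ?G"
  interpret P: pair_prob_space ?G ?G ..
  have pm[measurable]: "(\<lambda>x. p x j) \<in> borel_measurable ?G" for j
    unfolding p_def gauss_space_def by measurable
  have vm[measurable]: "(\<lambda>x. clip k (p x) j) \<in> borel_measurable ?G" for j
    unfolding clip_def by measurable
  have Dm[measurable]: "D \<in> borel_measurable ?G" unfolding D_def by measurable
  define R2 where "R2 = (\<lambda>x. \<Sum>j<k. (p x j)\<^sup>2)"
  have R2m[measurable]: "R2 \<in> borel_measurable ?G" unfolding R2_def by measurable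
  have R2: "0 \<le> R2 x" for x unfolding R2_def by (intro sum_nonneg) auto
  have iR: "integrable ?G R2" and vR: "(\<integral>x. R2 x \<partial>?G) \<le> 1"
    using total unfolding R2_def p_def gauss_space_def by (simp_all add: gauss.mlpoly_second_moment)
  have D: "0 \<le> D x" "D x \<le> R2 x" for x
  proof -
    show "0 \<le> D x" by (simp add: D_def)
    have "D x = (max 0 (sqrt (R2 x) - 1))\<^sup>2" by (simp add: D_def R2_def)
    also have "\<dots> \<le> (sqrt (R2 x))\<^sup>2" using R2[of x] by (intro power_mono) auto
    finally have "D x \<le> (sqrt (R2 x))\<^sup>2" .
    then show "D x \<le> R2 x" using R2 by simp
  qed
  show iD: "integrable ?G D"
    by (rule Bochner_Integration.integrable_bound[OF iR]) (use D R2 in auto)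
  show "gauss_ball_fun n k (\<lambda>x. clip k (p x))"
    unfolding gauss_ball_fun_def in_ball_k_def using clip_in_ball by auto
  define y where "y = (\<lambda>w. corr n \<rho> (fst w) (snd w))"
  have ym[measurable]: "y \<in> measurable ?P ?G" unfolding y_def using measurable_corr by (simp add: split_beta')
  have dy: "distr ?P ?G y = ?G" using distr_corr[OF \<rho>, of n] by (simp add: y_def split_beta')
  have dx: "distr ?P ?G fst = ?G" by (rule gauss_prob.distr_pair_fst)
  have iy: "integrable ?P (\<lambda>w. h (y w))" "(\<integral>w. h (y w) \<partial>?P) = (\<integral>x. h x \<partial>?G)"
    if "integrable ?G h" for h :: "_ \<Rightarrow> real"
    using that integrable_distr_eq[OF ym, of h] integral_distr[OF ym, of h] unfolding dy by auto
  have ix: "integrable ?P (\<lambda>w. h (fst w))" "(\<integral>w. h (fst w) \<partial>?P) = (\<integral>x. h x \<partial>?G)"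
    if "integrable ?G h" for h :: "_ \<Rightarrow> real"
    using that integrable_distr_eq[of fst ?P ?G h] integral_distr[of fst ?P ?G h] unfolding dx by auto
  have [measurable]: "(\<lambda>w. p (y w) j) \<in> borel_measurable ?P" "(\<lambda>w. clip k (p (y w)) j) \<in> borel_measurable ?P" for j
    using measurable_compose[OF ym pm] measurable_compose[OF ym vm] by auto
  have ip: "integrable ?P (\<lambda>w. inner_k k (p (fst w)) (p (y w)))"
  proof (rule Bochner_Integration.integrable_bound)
    show "integrable ?P (\<lambda>w. (R2 (fst w) + R2 (y w)) / 2)" using ix[OF iR] iy[OF iR] by simp
    show "(\<lambda>w. inner_k k (p (fst w)) (p (y w))) \<in> borel_measurable ?P" unfolding inner_k_def by measurable
    have "\<bar>inner_k k u v\<bar> \<le> ((\<Sum>j<k. (u j)\<^sup>2) + (\<Sum>j<k. (v j)\<^sup>2)) / 2" for u v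
      using sum_mult_le_weighted[where \<theta>=1 and k=k and a=u and b=v] sum_mult_le_weighted[where \<theta>=1 and k=k and a="\<lambda>j. - u j" and b=v]
      unfolding inner_k_def by (simp add: sum_negf)
    then show "AE w in ?P. norm (inner_k k (p (fst w)) (p (y w))) \<le> norm ((R2 (fst w) + R2 (y w)) / 2)"
      unfolding R2_def by (auto intro: order_trans[OF _ abs_ge_self])
  qed
  have iv: "integrable ?P (\<lambda>w. inner_k k (clip k (p (fst w))) (clip k (p (y w))))"
  proof (rule P.integrable_const_bound[where B=1])
    show "(\<lambda>w. inner_k k (clip k (p (fst w))) (clip k (p (y w)))) \<in> borel_measurable ?P"
      unfolding inner_k_def by measurable
    have "\<bar>inner_k k (clip k u) (clip k v)\<bar> \<le> 1" for u v
      using sum_mult_le_weighted[where \<theta>=1 and k=k and a="clip k u" and b="clip k v"] clip_in_ball[of k u] clip_in_ball[of k v]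
        sum_mult_le_weighted[where \<theta>=1 and k=k and a="\<lambda>j. - clip k u j" and b="clip k v"]
      unfolding inner_k_def by (simp add: sum_negf)
    then show "AE w in ?P. norm (inner_k k (clip k (p (fst w))) (clip k (p (y w)))) \<le> 1" by auto
  qed
  have sp: "gauss_stab n k \<rho> p = (\<integral>w. inner_k k (p (fst w)) (p (y w)) \<partial>?P)"
    using P.integral_fst'[OF ip] by (simp add: gauss_stab_def y_def)
  have sv: "gauss_stab n k \<rho> (\<lambda>x. clip k (p x)) = (\<integral>w. inner_k k (clip k (p (fst w))) (clip k (p (y w))) \<partial>?P)"
    using P.integral_fst'[OF iv] by (simp add: gauss_stab_def y_def)
  have "gauss_stab n k \<rho> (\<lambda>x. clip k (p x))
      \<le> (\<integral>w. inner_k k (p (fst w)) (p (y w)) + (D (fst w) / \<theta> + \<theta> * R2 (y w) + D (y w) / \<theta> + \<theta>) / 2 \<partial>?P)"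
    unfolding sv
  proof (rule integral_mono[OF iv])
    show "integrable ?P (\<lambda>w. inner_k k (p (fst w)) (p (y w)) + (D (fst w) / \<theta> + \<theta> * R2 (y w) + D (y w) / \<theta> + \<theta>) / 2)"
      using ip ix[OF iD] iy[OF iD] iy[OF iR] by simp
    show "inner_k k (clip k (p (fst w))) (clip k (p (y w)))
      \<le> inner_k k (p (fst w)) (p (y w)) + (D (fst w) / \<theta> + \<theta> * R2 (y w) + D (y w) / \<theta> + \<theta>) / 2" for w
      using inner_clip_le[OF \<theta>, of k "p (fst w)" "p (y w)"] by (simp add: clip_dist D_def R2_def)
  qed
  also have "\<dots> = gauss_stab n k \<rho> p
      + ((\<integral>x. D x \<partial>?G) / \<theta> + \<theta> * (\<integral>x. R2 x \<partial>?G) + (\<integral>x. D x \<partial>?G) / \<theta> + \<theta>) / 2"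
    unfolding sp using ip ix[OF iD] iy[OF iD] iy[OF iR] by (simp add: P.prob_space)
  also have "\<dots> \<le> gauss_stab n k \<rho> p + ((\<integral>x. D x \<partial>?G) / \<theta> + \<theta> * 1 + (\<integral>x. D x \<partial>?G) / \<theta> + \<theta>) / 2"
    using vR \<theta> by (intro add_left_mono divide_right_mono add_mono mult_left_mono) auto
  finally show "gauss_stab n k \<rho> (\<lambda>x. clip k (p x)) \<le> gauss_stab n k \<rho> p + \<theta> + (\<integral>x. D x \<partial>gauss_space n) / \<theta>"
    by (simp add: field_simps)
qed

lemma mlpoly_restrict: "mlpoly I c (restrict x I) = mlpoly I c x"
  unfolding mlpoly_def chi_def by (intro sum.cong arg_cong2[of _ _ _ _ "(*)"] prod.cong refl) auto

text \<open>Dummy coordinates are added because the hypothesis needs dimension at least \<open>k\<close>.\<close>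

lemma gauss_stab_ge_Fstar:
  fixes c :: "nat \<Rightarrow> nat set \<Rightarrow> real"
  assumes H: "\<forall>n\<ge>k. \<forall>r\<in>{-1..0}. \<forall>g. gauss_ball_fun n k g \<longrightarrow>
              gauss_stab n k r g \<ge> gauss_stab n k r (f_opt k)"
    and \<rho>: "-1 \<le> \<rho>" "\<rho> \<le> 0" and \<theta>: "0 < \<theta>" and \<eta>: "0 < \<eta>"
    and total: "(\<Sum>j<k. \<Sum>S\<in>Pow {..<n}. (c j S)\<^sup>2) \<le> 1"
  shows "Fstar k \<rho> \<le> (\<Sum>j<k. \<Sum>S\<in>Pow {..<n}. \<rho> ^ card S * (c j S)\<^sup>2) + \<theta>
     + (\<eta>\<^sup>2 + ((\<eta> + 2) / \<eta>)\<^sup>2 * (\<integral>x. excess_loss (\<Sum>j<k. (mlpoly {..<n} (c j) x)\<^sup>2) \<partial>gauss_space n)) / \<theta>"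
proof -
  define N where "N = n + k"
  have N: "n \<le> N" "k \<le> N" by (auto simp: N_def)
  \<comment> \<open>Zero outside subsets of \<open>{..<n}\<close>, so that the polynomial ignores
    the added coordinates.\<close>
  define c' where "c' = (\<lambda>j S. if S \<subseteq> {..<n} then c j S else 0)"
  have sub: "(\<Sum>S\<in>Pow {..<N}. g S) = (\<Sum>S\<in>Pow {..<n}. g S)" if "\<And>S. \<not> S \<subseteq> {..<n} \<Longrightarrow> g S = 0" for g :: "nat set \<Rightarrow> real"
    using that N by (intro sum.mono_neutral_right) auto
  have p: "mlpoly {..<N} (c' j) x = mlpoly {..<n} (c j) x" for j x
    unfolding mlpoly_def by (subst sub) (auto simp: c'_def)
  have total': "(\<Sum>j<k. \<Sum>S\<in>Pow {..<N}. (c' j S)\<^sup>2) \<le> 1"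
    using total by (subst sub) (auto simp: c'_def)
  have stab: "(\<Sum>S\<in>Pow {..<N}. \<rho> ^ card S * (c' j S)\<^sup>2) = (\<Sum>S\<in>Pow {..<n}. \<rho> ^ card S * (c j S)\<^sup>2)" for j
    by (subst sub) (auto simp: c'_def)
  have \<rho>1: "\<bar>\<rho>\<bar> \<le> 1" using \<rho> by auto
  define q where "q = (\<lambda>x j. mlpoly {..<n} (c j) x)"
  define D where "D = (\<lambda>x. (max 0 (sqrt (\<Sum>j<k. (q x j)\<^sup>2) - 1))\<^sup>2)"
  define E where "E = (\<lambda>x. excess_loss (\<Sum>j<k. (q x j)\<^sup>2))"
  have C: "gauss_ball_fun N k (\<lambda>x. clip k (q x))" "integrable (gauss_space N) D"
    "gauss_stab N k \<rho> (\<lambda>x. clip k (q x)) \<le> gauss_stab N k \<rho> q + \<theta> + (\<integral>x. D x \<partial>gauss_space N) / \<theta>"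
    using gauss_stab_clip[OF \<rho>1 \<theta> total'] unfolding p q_def D_def by auto
  have "Fstar k \<rho> = gauss_stab N k \<rho> (f_opt k)" using gauss_stab_f_opt[OF N(2)] by simp
  also have "\<dots> \<le> gauss_stab N k \<rho> (\<lambda>x. clip k (q x))" using H N(2) \<rho> C(1) by auto
  also have "\<dots> \<le> gauss_stab N k \<rho> q + \<theta> + (\<integral>x. D x \<partial>gauss_space N) / \<theta>" by (rule C)
  also have "gauss_stab N k \<rho> q = (\<Sum>j<k. \<Sum>S\<in>Pow {..<n}. \<rho> ^ card S * (c j S)\<^sup>2)"
    using gauss_stab_mlpoly[of N k \<rho> c'] unfolding p stab q_def by simp
  also have "(\<integral>x. D x \<partial>gauss_space N) \<le> \<eta>\<^sup>2 + ((\<eta> + 2) / \<eta>)\<^sup>2 * (\<integral>x. E x \<partial>gauss_space N)"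
  proof -
    have qm[measurable]: "(\<lambda>x. q x j) \<in> borel_measurable (gauss_space N)" for j
      unfolding q_def p[symmetric] gauss_space_def by measurable
    have "integrable (gauss_space N) (\<lambda>x. \<Sum>j<k. (q x j)\<^sup>2)"
      unfolding q_def p[symmetric] gauss_space_def by (simp add: gauss.mlpoly_second_moment)
    then have iE: "integrable (gauss_space N) E"
    proof (rule Bochner_Integration.integrable_bound)
      show "E \<in> borel_measurable (gauss_space N)" unfolding E_def by measurable
      show "AE x in gauss_space N. norm (E x) \<le> norm (\<Sum>j<k. (q x j)\<^sup>2)"
        by (auto simp: E_def sum_nonneg excess_loss_nonneg excess_loss_le_self)
    qed
    have "(\<integral>x. D x \<partial>gauss_space N) \<le> (\<integral>x. \<eta>\<^sup>2 + ((\<eta> + 2) / \<eta>)\<^sup>2 * E x \<partial>gauss_space N)"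
    proof (rule integral_mono[OF C(2)])
      show "integrable (gauss_space N) (\<lambda>x. \<eta>\<^sup>2 + ((\<eta> + 2) / \<eta>)\<^sup>2 * E x)" using iE by simp
      show "D x \<le> \<eta>\<^sup>2 + ((\<eta> + 2) / \<eta>)\<^sup>2 * E x" for x
        using excess_loss_lower[OF _ \<eta>, of "sqrt (\<Sum>j<k. (q x j)\<^sup>2)"] by (simp add: D_def E_def sum_nonneg)
    qed
    then show ?thesis using iE by (simp add: gauss_prob.prob_space)
  qed
  also have "(\<integral>x. E x \<partial>gauss_space N) = (\<integral>x. E x \<partial>gauss_space n)"
  proof -
    have qm[measurable]: "(\<lambda>x. q x j) \<in> borel_measurable (gauss_space n)" for j
      unfolding q_def gauss_space_def by measurable
    have Em: "E \<in> borel_measurable (gauss_space n)" unfolding E_def by measurable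
    have "E (restrict x {..<n}) = E x" for x by (simp add: E_def q_def mlpoly_restrict)
    then show ?thesis using integral_gauss_restrict[OF N(1) Em] by simp
  qed
  finally show ?thesis using \<theta> by (simp add: E_def q_def divide_right_mono)
qed

section \<open>Choice of parameters and assembly of the errors\<close>

text \<open>Degrees above \<open>D\<close> are harmless because
  \<open>\<bar>\<rho>\<bar> ^ D\<close> is small, degrees up to \<open>D\<close> because
  \<open>r\<close> is so near 1 that \<open>1 - (r ^ D)\<^sup>2\<close> is small. Uniformity over
  \<open>m \<ge> D\<close> lets \<open>m\<close> be chosen after \<open>r\<close>.\<close>

lemma power_noise_uniform:
  fixes \<rho> \<epsilon> :: real
  assumes "\<bar>\<rho>\<bar> < 1" "0 < \<epsilon>"
  obtains r D where "0 < r" "r < 1"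
    "\<And>m d. D \<le> m \<Longrightarrow> \<bar>\<rho> ^ d * (1 - (if d \<le> m then (r ^ d)\<^sup>2 else 0))\<bar> \<le> \<epsilon>"
proof -
  obtain D where D: "\<bar>\<rho>\<bar> ^ D < \<epsilon>" using real_arch_pow_inv[OF assms(2,1)] by blast
  \<comment> \<open>By Bernoulli, \<open>1 - (1 - h) ^ (2 * D) \<le> 2 * D * h\<close>; the
    \<open>+ 1\<close> covers \<open>D = 0\<close>, and the cap 1/2 keeps \<open>r\<close>
    positive.\<close>
  define h where "h = min (1/2) (\<epsilon> / (2 * real D + 1))"
  define r where "r = 1 - h"
  have h: "0 < h" "h \<le> 1/2" "h * (2 * real D) \<le> \<epsilon>"
  proof -
    show "0 < h" using assms by (auto simp: h_def)
    show "h \<le> 1/2" unfolding h_def by (rule min.cobounded1)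
    have "h * (2 * real D) \<le> \<epsilon> / (2 * real D + 1) * (2 * real D + 1)"
      using assms by (intro mult_mono) (auto simp: h_def)
    then show "h * (2 * real D) \<le> \<epsilon>" by simp
  qed
  have r: "0 < r" "r < 1" using h by (auto simp: r_def)
  have rD: "1 - (r ^ D)\<^sup>2 \<le> \<epsilon>"
  proof -
    have "1 + real (2 * D) * (- h) \<le> (1 + (- h)) ^ (2 * D)" using h by (intro Bernoulli_inequality) auto
    then show ?thesis using h by (simp add: r_def power_mult[symmetric] mult.commute)
  qed
  show thesis
  proof (rule that[OF r])
    fix m d assume m: "D \<le> m"
    define s where "s = (if d \<le> m then (r ^ d)\<^sup>2 else 0)"
    have s: "0 \<le> s" "s \<le> 1" using r by (auto simp: s_def power_le_one)
    have eq: "\<bar>\<rho> ^ d * (1 - s)\<bar> = \<bar>\<rho>\<bar> ^ d * (1 - s)" using s by (simp add: abs_mult power_abs)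
    have "\<bar>\<rho>\<bar> ^ d * (1 - s) \<le> \<epsilon>"
    proof (cases "d \<le> D")
      case True
      have "(r ^ D)\<^sup>2 \<le> (r ^ d)\<^sup>2" using r True by (intro power_mono power_decreasing) auto
      then have "1 - s \<le> \<epsilon>" using rD True m by (simp add: s_def)
      moreover have "\<bar>\<rho>\<bar> ^ d \<le> 1" using assms by (simp add: power_le_one)
      ultimately show ?thesis using s mult_mono[of "\<bar>\<rho>\<bar> ^ d" 1 "1 - s" \<epsilon>] by simp
    next
      case False
      then have "\<bar>\<rho>\<bar> ^ d \<le> \<bar>\<rho>\<bar> ^ D" using assms by (intro power_decreasing) auto
      then show ?thesis using s D mult_mono[of "\<bar>\<rho>\<bar> ^ d" \<epsilon> "1 - s" 1] assms by simp
    qed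
    then show "\<bar>\<rho> ^ d * (1 - (if d \<le> m then (r ^ d)\<^sup>2 else 0))\<bar> \<le> \<epsilon>" unfolding s_def[symmetric] eq .
  qed
qed

text \<open>The direction matches the Gaussian estimate, which bounds the truncated sum from below.
  The error does not grow with the number of sets because the total Fourier weight is at most
  1.\<close>

lemma bool_stab_trunc:
  assumes f: "\<And>x. x \<in> cube n \<Longrightarrow> in_ball_k k (f x)" and e: "0 \<le> \<epsilon>"
    and r: "\<And>d. \<bar>\<rho> ^ d * (1 - (if d \<le> m then (r ^ d)\<^sup>2 else 0))\<bar> \<le> \<epsilon>"
  shows "(\<Sum>j<k. \<Sum>S\<in>Pow {..<n}. \<rho> ^ card S * (trunc_coeff n m r f j S)\<^sup>2) \<le> bool_stab n k \<rho> f + \<epsilon>"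
proof -
  define W where "W = (\<lambda>j S. (fourier n (\<lambda>x. f x j) S)\<^sup>2)"
  have W: "0 \<le> W j S" for j S by (simp add: W_def)
  have "(\<Sum>j<k. \<Sum>S\<in>Pow {..<n}. \<rho> ^ card S * (trunc_coeff n m r f j S)\<^sup>2)
      \<le> (\<Sum>j<k. \<Sum>S\<in>Pow {..<n}. \<rho> ^ card S * W j S + \<epsilon> * W j S)"
  proof (intro sum_mono)
    fix j and S :: "nat set"
    define d where "d = card S"
    define s where "s = (if d \<le> m then (r ^ d)\<^sup>2 else 0)"
    have t: "(trunc_coeff n m r f j S)\<^sup>2 = s * W j S"
      by (simp add: trunc_coeff_def s_def W_def d_def power_mult_distrib)
    have "- (\<rho> ^ d * (1 - s)) \<le> \<epsilon>" using r[of d] unfolding s_def by linarith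
    then have "- (\<rho> ^ d * (1 - s)) * W j S \<le> \<epsilon> * W j S" using W by (rule mult_right_mono)
    then show "\<rho> ^ card S * (trunc_coeff n m r f j S)\<^sup>2 \<le> \<rho> ^ card S * W j S + \<epsilon> * W j S"
      unfolding t d_def[symmetric] by (simp add: algebra_simps)
  qed
  also have "\<dots> = (\<Sum>j<k. \<Sum>S\<in>Pow {..<n}. \<rho> ^ card S * W j S) + \<epsilon> * (\<Sum>j<k. \<Sum>S\<in>Pow {..<n}. W j S)"
    by (simp add: sum.distrib sum_distrib_left)
  also have "(\<Sum>j<k. \<Sum>S\<in>Pow {..<n}. \<rho> ^ card S * W j S) = bool_stab n k \<rho> f"
    unfolding bool_stab_fourier W_def sum_distrib_left by (rule sum.swap)
  also have "\<epsilon> * (\<Sum>j<k. \<Sum>S\<in>Pow {..<n}. W j S) \<le> \<epsilon> * 1"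
    unfolding W_def using ball_fourier_total[OF f] e by (intro mult_left_mono) auto
  finally show ?thesis by simp
qed

text \<open>Truncation leaves only low-degree influences and noise shrinks them, which is how the
  assumption on \<open>low_inf\<close> reaches \<open>lindeberg\<close>.\<close>

lemma trunc_coeff_influence:
  assumes r: "0 \<le> r" "r \<le> 1"
  shows "(\<Sum>S\<in>{S. S \<subseteq> {..<n} \<and> i \<in> S}. (trunc_coeff n m r f j S)\<^sup>2) \<le> low_inf n m i (\<lambda>x. f x j)"
proof -
  have fin: "finite {S. S \<subseteq> {..<n} \<and> i \<in> S}" by (rule finite_subset[of _ "Pow {..<n}"]) auto
  have "(\<Sum>S\<in>{S. S \<subseteq> {..<n} \<and> i \<in> S}. (trunc_coeff n m r f j S)\<^sup>2)
      = (\<Sum>S\<in>{S. S \<subseteq> {..<n} \<and> card S \<le> m \<and> i \<in> S}. (trunc_coeff n m r f j S)\<^sup>2)"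
    using fin by (intro sum.mono_neutral_right) (auto simp: trunc_coeff_def)
  also have "\<dots> \<le> low_inf n m i (\<lambda>x. f x j)"
    unfolding low_inf_def by (intro sum_mono trunc_coeff_sq_le r)
  finally show ?thesis .
qed

text \<open>The penalty is small on the cube, and the replacement argument carries it to Gaussian
  space. The first error is made small through \<open>m\<close> once \<open>r\<close> is fixed, the
  second through \<open>l\<close> once \<open>m\<close> is fixed.\<close>

lemma gauss_excess_loss:
  assumes f: "\<And>x. x \<in> cube n \<Longrightarrow> in_ball_k k (f x)" and r: "0 \<le> r" "r \<le> 1" and l: "0 < l"
    and inf: "\<And>i. i < n \<Longrightarrow> (\<Sum>j<k. low_inf n m i (\<lambda>x. f x j)) \<le> l\<^sup>2"
  shows "(\<integral>x. excess_loss (\<Sum>j<k. (mlpoly {..<n} (trunc_coeff n m r f j) x)\<^sup>2) \<partial>gauss_space n)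
    \<le> 16 * (r ^ m)\<^sup>2 + 544 * (1 + 3 * real k * 9 ^ m) * real m * l"
proof -
  interpret R: standardised_family "\<lambda>_. rademacher" by unfold_locales (rule standardised_rademacher)
  define c where "c = trunc_coeff n m r f"
  define E where "E = (\<lambda>x. excess_loss (\<Sum>j<k. (mlpoly {..<n} (c j) x)\<^sup>2))"
  have total: "(\<Sum>j<k. \<Sum>S\<in>Pow {..<n}. (c j S)\<^sup>2) \<le> 1"
    by (rule order_trans[OF _ ball_fourier_total[OF f]]) (auto intro!: sum_mono trunc_coeff_sq_le r simp: c_def)
  have "(\<integral>x. E x \<partial>PiM {..<n} (\<lambda>_. rademacher)) = (\<Sum>x\<in>cube n. E x) / 2 ^ n"
    by (rule integral_PiM_rademacher) (auto simp: E_def intro!: excess_loss_nonneg sum_nonneg)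
  also have "\<dots> \<le> 16 * (r ^ m)\<^sup>2"
    unfolding E_def c_def by (rule cube_excess_loss[OF f r])
  finally have "(\<integral>x. E x \<partial>PiM {..<n} (\<lambda>_. rademacher)) \<le> 16 * (r ^ m)\<^sup>2" .
  moreover have "\<bar>(\<integral>x. E x \<partial>PiM {..<n} (\<lambda>_. rademacher)) - (\<integral>x. E x \<partial>PiM {..<n} (\<lambda>_. std_normal_distribution))\<bar>
      \<le> 544 * (1 + 3 * real k * 9 ^ m) * real m * l"
    unfolding E_def
  proof (rule lindeberg[OF standardised_rademacher standardised_std_normal l _ _ total])
    show "c j S = 0" if "m < card S" for j S using that by (simp add: c_def trunc_coeff_def)
    show "(\<Sum>j<k. \<Sum>S\<in>{S. S \<subseteq> {..<n} \<and> i \<in> S}. (c j S)\<^sup>2) \<le> l\<^sup>2" if "i < n" for i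
      by (rule order_trans[OF _ inf[OF that]]) (auto simp: c_def intro!: sum_mono trunc_coeff_influence r)
  qed
  ultimately show ?thesis unfolding E_def c_def gauss_space_def by linarith
qed

theorem theorem10p1:
  fixes k :: nat and \<rho> :: real
  assumes hk: "k \<ge> 1"
    and H: "\<forall>n\<ge>k. \<forall>r\<in>{-1..0}. \<forall>g. gauss_ball_fun n k g \<longrightarrow>
              gauss_stab n k r g \<ge> gauss_stab n k r (f_opt k)"
    and hrho: "-1 < \<rho>" "\<rho> \<le> 0"
  shows "\<forall>\<epsilon>>0. \<exists>\<delta>>0. \<exists>m::nat. \<forall>(n::nat) (f :: (nat \<Rightarrow> real) \<Rightarrow> nat \<Rightarrow> real).
           (\<forall>x\<in>cube n. in_ball_k k (f x)) \<and>
           (\<forall>i<n. (\<Sum>j<k. low_inf n m i (\<lambda>x. f x j)) \<le> \<delta>)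
           \<longrightarrow> bool_stab n k \<rho> f \<ge> Fstar k \<rho> - \<epsilon>"
proof (intro allI impI)
  fix \<epsilon> :: real assume \<epsilon>: "0 < \<epsilon>"
  \<comment> \<open>Error budget for \<open>\<epsilon> = 4 * \<theta>\<close>: half goes to noise
    and truncation, one \<open>\<theta>\<close> to the Young term in clipping, one to
    \<open>(\<eta>\<^sup>2 + L * E) / \<theta>\<close>. As \<open>\<eta>\<^sup>2\<close> is a
    quarter of \<open>\<theta>\<^sup>2\<close>, \<open>\<kappa>\<close> is set so that
    \<open>E \<le> 2 * \<kappa>\<close> makes \<open>L * E\<close> at most half of it.\<close>
  define \<theta> where "\<theta> = \<epsilon> / 4"
  define \<eta> where "\<eta> = \<theta> / 2"
  define L where "L = ((\<eta> + 2) / \<eta>)\<^sup>2"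
  define \<kappa> where "\<kappa> = \<theta>\<^sup>2 / (4 * L)"
  have pos: "0 < \<theta>" "0 < \<eta>" "0 < L" "0 < \<kappa>" using \<epsilon> by (auto simp: \<theta>_def \<eta>_def L_def \<kappa>_def)
  obtain r D where r: "0 < r" "r < 1"
    and rD: "\<And>m d. D \<le> m \<Longrightarrow> \<bar>\<rho> ^ d * (1 - (if d \<le> m then (r ^ d)\<^sup>2 else 0))\<bar> \<le> \<epsilon> / 2"
    using power_noise_uniform[of \<rho> "\<epsilon> / 2"] hrho \<epsilon> by auto
  obtain m0 where m0: "r ^ m0 < sqrt (\<kappa> / 16)"
    using real_arch_pow_inv[of "sqrt (\<kappa> / 16)" r] r pos by auto
  define m where "m = max D m0"
  have rm: "16 * (r ^ m)\<^sup>2 \<le> \<kappa>"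
  proof -
    have "r ^ m \<le> r ^ m0" using r by (intro power_decreasing) (auto simp: m_def)
    then have "r ^ m \<le> sqrt (\<kappa> / 16)" using m0 by linarith
    then have "(r ^ m)\<^sup>2 \<le> (sqrt (\<kappa> / 16))\<^sup>2" using r by (intro power_mono) auto
    then show ?thesis using pos by simp
  qed
  define C where "C = 544 * (1 + 3 * real k * 9 ^ m) * real m"
  have C: "0 \<le> C" by (simp add: C_def)
  \<comment> \<open>The denominator is \<open>C + 1\<close> because \<open>C\<close> is 0 when
    \<open>m\<close> is 0.\<close>
  define l where "l = \<kappa> / (C + 1)"
  have l: "0 < l" "C * l \<le> \<kappa>" using C pos by (auto simp: l_def field_simps)
  show "\<exists>\<delta>>0. \<exists>m::nat. \<forall>(n::nat) (f :: (nat \<Rightarrow> real) \<Rightarrow> nat \<Rightarrow> real).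
           (\<forall>x\<in>cube n. in_ball_k k (f x)) \<and>
           (\<forall>i<n. (\<Sum>j<k. low_inf n m i (\<lambda>x. f x j)) \<le> \<delta>)
           \<longrightarrow> bool_stab n k \<rho> f \<ge> Fstar k \<rho> - \<epsilon>"
  \<comment> \<open>The influence threshold is a square because \<open>lindeberg\<close> turns
    influences at most \<open>l\<^sup>2\<close> into an error linear in \<open>l\<close>.\<close>
  proof (intro exI[of _ "l\<^sup>2"] conjI exI[of _ m] allI impI)
    show "0 < l\<^sup>2" using l by simp
    fix n and f :: "(nat \<Rightarrow> real) \<Rightarrow> nat \<Rightarrow> real"
    assume "(\<forall>x\<in>cube n. in_ball_k k (f x)) \<and> (\<forall>i<n. (\<Sum>j<k. low_inf n m i (\<lambda>x. f x j)) \<le> l\<^sup>2)"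
    then have f: "\<And>x. x \<in> cube n \<Longrightarrow> in_ball_k k (f x)"
      and inf: "\<And>i. i < n \<Longrightarrow> (\<Sum>j<k. low_inf n m i (\<lambda>x. f x j)) \<le> l\<^sup>2" by auto
    have r': "0 \<le> r" "r \<le> 1" using r by auto
    define c where "c = trunc_coeff n m r f"
    define E where "E = (\<integral>x. excess_loss (\<Sum>j<k. (mlpoly {..<n} (c j) x)\<^sup>2) \<partial>gauss_space n)"
    have total: "(\<Sum>j<k. \<Sum>S\<in>Pow {..<n}. (c j S)\<^sup>2) \<le> 1"
      by (rule order_trans[OF _ ball_fourier_total[OF f]]) (auto intro!: sum_mono trunc_coeff_sq_le r' simp: c_def)
    have "E \<le> 2 * \<kappa>"
      using gauss_excess_loss[OF f r' l(1) inf] rm l(2) unfolding E_def c_def C_def by linarith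
    then have "L * E \<le> L * (2 * \<kappa>)" using pos by (intro mult_left_mono) auto
    also have "\<dots> = \<theta>\<^sup>2 / 2" using pos by (simp add: \<kappa>_def)
    finally have "L * E \<le> \<theta>\<^sup>2 / 2" .
    moreover have "\<eta>\<^sup>2 = \<theta>\<^sup>2 / 4" by (simp add: \<eta>_def power_divide)
    ultimately have "\<eta>\<^sup>2 + L * E \<le> \<theta>\<^sup>2" using zero_le_power2[of \<theta>] by linarith
    then have "(\<eta>\<^sup>2 + L * E) / \<theta> \<le> \<theta>" using pos by (simp add: field_simps power2_eq_square)
    moreover have "Fstar k \<rho> \<le> (\<Sum>j<k. \<Sum>S\<in>Pow {..<n}. \<rho> ^ card S * (c j S)\<^sup>2) + \<theta> + (\<eta>\<^sup>2 + L * E) / \<theta>"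
      unfolding L_def E_def using hrho by (intro gauss_stab_ge_Fstar H pos total) auto
    moreover have "(\<Sum>j<k. \<Sum>S\<in>Pow {..<n}. \<rho> ^ card S * (c j S)\<^sup>2) \<le> bool_stab n k \<rho> f + \<epsilon> / 2"
      unfolding c_def using \<epsilon> by (intro bool_stab_trunc f rD) (auto simp: m_def)
    moreover have "\<epsilon> = 4 * \<theta>" by (simp add: \<theta>_def)
    ultimately show "Fstar k \<rho> - \<epsilon> \<le> bool_stab n k \<rho> f" by linarith
  qed
qed

end
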